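(* There exists a universal constant $C>0$ such that the following holds. Let $\mathcal{K}$ be the Koopman operator of a measure-preserving dynamical system on $L^2(\Omega,\omega)$, and let $\mathbb{K}\in\mathbb{C}^{N\times N}$ be an mpEDMD matrix computed from a dictionary of size $N$ and $M$ snapshots, with Gram matrix $G$ (see context). For any $L\in\mathbb{N}$, any $g\in L^2(\Omega,\omega)$ with $\|g\|=1$ and any $\pmb{g}\in\mathbb{C}^N$ with $\pmb{g}^*G\pmb{g}=1$, $$ W_1\left(\mu_g,\mu_{\pmb{g}}^{(N,M)}\right)\leq C\left(\frac{\log(L)}{L}+\sum_{1\leq l\leq L}\frac{\left| \langle\mathcal{K}^{|l|}g,g\rangle-\pmb{g}^*G\mathbb{K}^{|l|}\pmb{g}\right|}{l}\right). $$
   Context: Setting. $\Omega\subseteq\mathbb{R}^d$, $\omega$ is a positive measure on $\Omega$, and $F:\Omega\to\Omega$ is measurable and preserves $\omega$. The Koopman operator $\mathcal{K}g=g\circ F$ is an isometry on $L^2(\Omega,\omega)$, whose inner product (linear in the first argument) and norm are $\langle\cdot,\cdot\rangle$ and $\|\cdot\|$. $\mathbb{T}$ is the unit circle in $\mathbb{C}$. Spectral measures of $\mathcal{K}$. There is a unitary operator $\mathcal{K}'$ on a Hilbert space $\mathcal{H}'\supseteq L^2(\Omega,\omega)$ (closed subspace) with $\mathcal{K}'|_{L^2(\Omega,\omega)}=\mathcal{K}$. Let $\mathcal{E}'$ be the projection-valued spectral measure of $\mathcal{K}'$ on $\mathbb{T}$ and $\mathcal{P}:\mathcal{H}'\to L^2(\Omega,\omega)$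 the orthogonal projection. The spectral measure of $\mathcal{K}$ is $\mathcal{E}(U)=\mathcal{P}\mathcal{E}'(U)\mathcal{P}^*$, $U\subset\mathbb{T}$ Borel; it does not depend on the choice of unitary extension. For $g\in L^2(\Omega,\omega)$ with $\|g\|=1$, $\mu_g$ is the Borel probability measure on $\mathbb{T}$ given by $\mu_g(U)=\langle\mathcal{E}(U)g,g\rangle$. mpEDMD. The dictionary is $\psi_1,\dots,\psi_N\in L^2(\Omega,\omega)$ and $\Psi(\pmb{x})=[\psi_1(\pmb{x})\ \cdots\ \psi_N(\pmb{x})]$. The data are points $\pmb{x}^{(m)}\in\Omega$, $\pmb{y}^{(m)}=F(\pmb{x}^{(m)})$, $m=1,\dots,M$, with quadrature weights $w_m\ge 0$; $W=\mathrm{diag}(w_1,\dots,w_M)$. $\Psi_X,\Psi_Y\in\mathbb{C}^{M\times N}$ are the matrices whose $m$th rows are $\Psi(\pmb{x}^{(m)})$ and $\Psi(\pmb{y}^{(m)})$. Put $G=\Psi_X^*W\Psi_X$ and $A=\Psi_X^*W\Psi_Y$; $G$ is assumed invertible. Take any singular value decomposition $G^{-1/2}A^*G^{-1/2}=U_1\Sigma U_2^*$ with $U_1,U_2$ unitary, and set $\mathbb{K}=G^{-1/2}U_2U_1^*G^{1/2}$. Take an eigendecomposition $U_2U_1^*=\hat V\Lambda\hat V^*$ with $\hat V$ unitary and $\Lambda=\mathrm{diag}(\lambda_1,\dots,\lambda_N)$, and let $v_j$ be the $j$th column of $V=G^{-1/2}\hat V$, so that $\mathbb{K}v_j=\lambda_jv_j$.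 For $\pmb{g}\in\mathbb{C}^N$ with $\pmb{g}^*G\pmb{g}=1$, $\mu_{\pmb{g}}^{(N,M)}$ is the probability measure on $\mathbb{T}$ given by $\mu_{\pmb{g}}^{(N,M)}(U)=\sum_{\lambda_j\in U}|v_j^*G\pmb{g}|^2$. Wasserstein distance. For Borel probability measures $\mu,\nu$ on $\mathbb{T}$, $W_1(\mu,\nu)=\sup\{\int_{\mathbb{T}}\phi\,d(\mu-\nu):\phi:\mathbb{T}\to\mathbb{R}\text{ Lipschitz with constant}\le1\}$, the Lipschitz constant being with respect to $|\lambda-\lambda'|$.
   Formalization: The bound is stated for L ≥ 2 only: for L = 1 the logarithm vanishes and it fails, e.g. for the doubling map with g = exp(2πit) and snapshots at 1/3, 2/3, where the right-hand side is 0 but the two measures differ. *)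

theory Defs
  imports "HOL-Analysis.Analysis" "Jordan_Normal_Form.Schur_Decomposition"
begin

no_notation Inner_Product.real_inner_class.inner (infix \<open>\<bullet>\<close> 70)

section \<open>The dynamical system and its Koopman operator\<close>

text \<open>
  The state space is a subset of \<open>\<real>\<^sup>d\<close>, coded as \<^term>\<open>carrier_vec d :: real Matrix.vec set\<close>.
  The dimension is thereby a number and not a type, so that a constant can be chosen before it.
  The sigma-algebra on \<open>\<Omega>\<close> is the one carried by \<open>\<omega>\<close>; measurability of \<open>F\<close>
  includes \<open>F ` \<Omega> \<subseteq> \<Omega>\<close>.
\<close>

definition measure_preserving_system ::
  "nat \<Rightarrow> real Matrix.vec set \<Rightarrow> real Matrix.vec measure \<Rightarrow> (real Matrix.vec \<Rightarrow> real Matrix.vec) \<Rightarrow> bool" where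
  "measure_preserving_system d \<Omega> \<omega> F \<longleftrightarrow>
     \<Omega> \<subseteq> carrier_vec d \<and> space \<omega> = \<Omega> \<and> F \<in> measurable \<omega> \<omega> \<and> distr \<omega> \<omega> F = \<omega>"

text \<open>
  Elements of \<open>L\<^sup>2\<close> are represented by square-integrable functions, two of which denote the
  same element iff they agree almost everywhere.
\<close>

definition L2_carrier :: "'a measure \<Rightarrow> ('a \<Rightarrow> complex) set" where
  "L2_carrier \<omega> = {f \<in> borel_measurable \<omega>. integrable \<omega> (\<lambda>x. (cmod (f x))\<^sup>2)}"

definition L2_inner :: "'a measure \<Rightarrow> ('a \<Rightarrow> complex) \<Rightarrow> ('a \<Rightarrow> complex) \<Rightarrow> complex" where
  "L2_inner \<omega> f g = (\<integral>x. f x * cnj (g x) \<partial>\<omega>)"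

definition L2_norm :: "'a measure \<Rightarrow> ('a \<Rightarrow> complex) \<Rightarrow> real" where
  "L2_norm \<omega> f = sqrt (\<integral>x. (cmod (f x))\<^sup>2 \<partial>\<omega>)"

definition koopman :: "('a \<Rightarrow> 'a) \<Rightarrow> ('a \<Rightarrow> complex) \<Rightarrow> 'a \<Rightarrow> complex" where
  "koopman F g = g \<circ> F"

section \<open>Complex Hilbert spaces and unitary operators\<close>

record 'h inner_space = "(complex, 'h) module" +
  hinner :: "'h \<Rightarrow> 'h \<Rightarrow> complex"

definition hdist :: "'h inner_space \<Rightarrow> 'h \<Rightarrow> 'h \<Rightarrow> real" where
  "hdist H x y = sqrt (Re (hinner H (x \<ominus>\<^bsub>H\<^esub> y) (x \<ominus>\<^bsub>H\<^esub> y)))"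

text \<open>\<^term>\<open>class_ring :: complex ring\<close> is the field of complex numbers.\<close>

definition hilbert_space :: "'h inner_space \<Rightarrow> bool" where
  "hilbert_space H \<longleftrightarrow>
     Module.module (class_ring :: complex ring) H \<and>
     (\<forall>x\<in>carrier H. \<forall>y\<in>carrier H. \<forall>z\<in>carrier H.
        hinner H (x \<oplus>\<^bsub>H\<^esub> y) z = hinner H x z + hinner H y z) \<and>
     (\<forall>c. \<forall>x\<in>carrier H. \<forall>y\<in>carrier H. hinner H (c \<odot>\<^bsub>H\<^esub> x) y = c * hinner H x y) \<and>
     (\<forall>x\<in>carrier H. \<forall>y\<in>carrier H. hinner H y x = cnj (hinner H x y)) \<and>
     (\<forall>x\<in>carrier H. 0 \<le> Re (hinner H x x)) \<and>
     (\<forall>x\<in>carrier H. hinner H x x = 0 \<longrightarrow> x = \<zero>\<^bsub>H\<^esub>) \<and>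
     Metric_space.mcomplete (carrier H) (hdist H)"

definition linear_operator :: "'h inner_space \<Rightarrow> ('h \<Rightarrow> 'h) \<Rightarrow> bool" where
  "linear_operator H T \<longleftrightarrow>
     T \<in> carrier H \<rightarrow> carrier H \<and>
     (\<forall>x\<in>carrier H. \<forall>y\<in>carrier H. T (x \<oplus>\<^bsub>H\<^esub> y) = T x \<oplus>\<^bsub>H\<^esub> T y) \<and>
     (\<forall>c. \<forall>x\<in>carrier H. T (c \<odot>\<^bsub>H\<^esub> x) = c \<odot>\<^bsub>H\<^esub> T x)"

definition unitary_operator :: "'h inner_space \<Rightarrow> ('h \<Rightarrow> 'h) \<Rightarrow> bool" where
  "unitary_operator H T \<longleftrightarrow>
     linear_operator H T \<and> bij_betw T (carrier H) (carrier H) \<and>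
     (\<forall>x\<in>carrier H. \<forall>y\<in>carrier H. hinner H (T x) (T y) = hinner H x y)"

definition selfadjoint_projection :: "'h inner_space \<Rightarrow> ('h \<Rightarrow> 'h) \<Rightarrow> bool" where
  "selfadjoint_projection H T \<longleftrightarrow>
     linear_operator H T \<and> (\<forall>x\<in>carrier H. T (T x) = T x) \<and>
     (\<forall>x\<in>carrier H. \<forall>y\<in>carrier H. hinner H (T x) y = hinner H x (T y))"

section \<open>Spectral measures on the unit circle\<close>

definition circle :: "complex measure" where
  "circle = restrict_space borel (sphere 0 1)"

definition projection_valued_measure ::
  "'h inner_space \<Rightarrow> (complex set \<Rightarrow> 'h \<Rightarrow> 'h) \<Rightarrow> bool" where
  "projection_valued_measure H E \<longleftrightarrow>
     (\<forall>U\<in>sets circle. selfadjoint_projection H (E U)) \<and>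
     (\<forall>x\<in>carrier H. E {} x = \<zero>\<^bsub>H\<^esub>) \<and>
     (\<forall>x\<in>carrier H. E (space circle) x = x) \<and>
     (\<forall>U\<in>sets circle. \<forall>V\<in>sets circle. \<forall>x\<in>carrier H. E (U \<inter> V) x = E U (E V x)) \<and>
     (\<forall>A :: nat \<Rightarrow> complex set. range A \<subseteq> sets circle \<longrightarrow> disjoint_family A \<longrightarrow>
        (\<forall>x\<in>carrier H. \<forall>y\<in>carrier H.
           (\<lambda>n. hinner H (E (A n) x) y) sums hinner H (E (\<Union>n. A n) x) y))"

text \<open>The positive measure \<open>U \<mapsto> \<langle>E(U)x, x\<rangle>\<close>, for any operator-valued \<open>E\<close> and inner product \<open>ip\<close>.\<close>

definition scalar_spectral_measure ::
  "('h \<Rightarrow> 'h \<Rightarrow> complex) \<Rightarrow> (complex set \<Rightarrow> 'h \<Rightarrow> 'h) \<Rightarrow> 'h \<Rightarrow> complex measure" where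
  "scalar_spectral_measure ip E x =
     measure_of (space circle) (sets circle) (\<lambda>U. ennreal (Re (ip (E U x) x)))"

text \<open>
  \<open>E\<close> is the spectral measure of \<open>T\<close>, i.e. \<open>T = \<integral> \<lambda> dE(\<lambda>)\<close>. The operator integral is the
  operator with quadratic form \<open>x \<mapsto> \<integral> \<lambda> d\<langle>E(\<lambda>)x, x\<rangle>\<close>, which determines it by polarization.
\<close>

definition spectral_measure_of ::
  "'h inner_space \<Rightarrow> ('h \<Rightarrow> 'h) \<Rightarrow> (complex set \<Rightarrow> 'h \<Rightarrow> 'h) \<Rightarrow> bool" where
  "spectral_measure_of H T E \<longleftrightarrow>
     projection_valued_measure H E \<and>
     (\<forall>x\<in>carrier H. hinner H (T x) x = (\<integral>z. z \<partial>scalar_spectral_measure (hinner H) E x))"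

text \<open>
  \<open>J\<close> identifies \<open>L\<^sup>2\<close> with a subspace of \<open>H\<close> (closed, as \<open>L\<^sup>2\<close> is complete) on which the
  unitary operator \<open>T\<close> acts as the Koopman operator. Being isometric, \<open>J\<close> identifies almost
  everywhere equal functions.
\<close>

definition koopman_unitary_extension ::
  "'a measure \<Rightarrow> ('a \<Rightarrow> 'a) \<Rightarrow> 'h inner_space \<Rightarrow> (('a \<Rightarrow> complex) \<Rightarrow> 'h) \<Rightarrow> ('h \<Rightarrow> 'h) \<Rightarrow> bool" where
  "koopman_unitary_extension \<omega> F H J T \<longleftrightarrow>
     hilbert_space H \<and> unitary_operator H T \<and>
     J \<in> L2_carrier \<omega> \<rightarrow> carrier H \<and>
     (\<forall>f\<in>L2_carrier \<omega>. \<forall>g\<in>L2_carrier \<omega>. J (\<lambda>x. f x + g x) = J f \<oplus>\<^bsub>H\<^esub> J g) \<and>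
     (\<forall>c. \<forall>f\<in>L2_carrier \<omega>. J (\<lambda>x. c * f x) = c \<odot>\<^bsub>H\<^esub> J f) \<and>
     (\<forall>f\<in>L2_carrier \<omega>. \<forall>g\<in>L2_carrier \<omega>. hinner H (J f) (J g) = L2_inner \<omega> f g) \<and>
     (\<forall>f\<in>L2_carrier \<omega>. T (J f) = J (koopman F f))"

definition orthogonal_projection_onto_L2 ::
  "'a measure \<Rightarrow> 'h inner_space \<Rightarrow> (('a \<Rightarrow> complex) \<Rightarrow> 'h) \<Rightarrow> ('h \<Rightarrow> 'a \<Rightarrow> complex) \<Rightarrow> bool" where
  "orthogonal_projection_onto_L2 \<omega> H J P \<longleftrightarrow>
     (\<forall>x\<in>carrier H. P x \<in> L2_carrier \<omega> \<and>
        (\<forall>f\<in>L2_carrier \<omega>. hinner H (x \<ominus>\<^bsub>H\<^esub> J (P x)) (J f) = 0))"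

text \<open>
  \<open>E\<close> is the compression to \<open>L\<^sup>2\<close> of the spectral measure of a unitary extension; up to almost
  everywhere equality it does not depend on that extension. The type underlying \<open>H\<close> is fixed to
  keep type variables (on which a constant could depend) out of statements about \<open>E\<close>. It has
  cardinality \<open>2\<^sup>\<cc>\<close>, where \<open>\<cc>\<close> is that of the continuum. This suffices to carry a unitary extension:
  \<open>L\<^sup>2\<close> has at most \<open>2\<^sup>\<cc>\<close> elements, hence so has the closed span of its images under the negative
  powers of a unitary extension, because \<open>(2\<^sup>\<cc>)\<close> raised to \<open>\<aleph>\<^sub>0\<close> is again \<open>2\<^sup>\<cc>\<close>.
\<close>

definition koopman_spectral_measure ::
  "real Matrix.vec measure \<Rightarrow> (real Matrix.vec \<Rightarrow> real Matrix.vec) \<Rightarrow>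
   (complex set \<Rightarrow> (real Matrix.vec \<Rightarrow> complex) \<Rightarrow> real Matrix.vec \<Rightarrow> complex) \<Rightarrow> bool" where
  "koopman_spectral_measure \<omega> F E \<longleftrightarrow>
     (\<exists>(H :: (real Matrix.vec \<Rightarrow> complex) inner_space) J T E' P.
        koopman_unitary_extension \<omega> F H J T \<and>
        spectral_measure_of H T E' \<and>
        orthogonal_projection_onto_L2 \<omega> H J P \<and>
        E = (\<lambda>U f. P (E' U (J f))))"

section \<open>mpEDMD\<close>

text \<open>Indices start at 0: the dictionary is \<open>\<psi> 0, \<dots>, \<psi> (N - 1)\<close>.\<close>

definition dict_mat :: "nat \<Rightarrow> nat \<Rightarrow> (nat \<Rightarrow> 'a \<Rightarrow> complex) \<Rightarrow> (nat \<Rightarrow> 'a) \<Rightarrow> complex mat" where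
  "dict_mat M N \<psi> x = Matrix.mat M N (\<lambda>(m, j). \<psi> j (x m))"

definition weight_mat :: "nat \<Rightarrow> (nat \<Rightarrow> real) \<Rightarrow> complex mat" where
  "weight_mat M w = mat_diag M (\<lambda>m. complex_of_real (w m))"

definition gram_mat ::
  "nat \<Rightarrow> nat \<Rightarrow> (nat \<Rightarrow> 'a \<Rightarrow> complex) \<Rightarrow> (nat \<Rightarrow> 'a) \<Rightarrow> (nat \<Rightarrow> real) \<Rightarrow> complex mat" where
  "gram_mat M N \<psi> x w = mat_adjoint (dict_mat M N \<psi> x) * weight_mat M w * dict_mat M N \<psi> x"

definition cross_mat ::
  "nat \<Rightarrow> nat \<Rightarrow> (nat \<Rightarrow> 'a \<Rightarrow> complex) \<Rightarrow> (nat \<Rightarrow> 'a) \<Rightarrow> (nat \<Rightarrow> 'a) \<Rightarrow> (nat \<Rightarrow> real) \<Rightarrow> complex mat"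
  where
  "cross_mat M N \<psi> x y w = mat_adjoint (dict_mat M N \<psi> x) * weight_mat M w * dict_mat M N \<psi> y"

definition unitary_mat :: "nat \<Rightarrow> complex mat \<Rightarrow> bool" where
  "unitary_mat n U \<longleftrightarrow>
     U \<in> carrier_mat n n \<and> mat_adjoint U * U = 1\<^sub>m n \<and> U * mat_adjoint U = 1\<^sub>m n"

definition positive_sqrt_mat :: "nat \<Rightarrow> complex mat \<Rightarrow> complex mat \<Rightarrow> bool" where
  "positive_sqrt_mat n G S \<longleftrightarrow>
     S \<in> carrier_mat n n \<and> mat_adjoint S = S \<and>
     (\<forall>v\<in>carrier_vec n. 0 \<le> Re ((S *\<^sub>v v) \<bullet>c v)) \<and> S * S = G"

text \<open>
  \<open>K\<close> is an mpEDMD matrix with (normalised) eigenvectors the columns of \<open>V\<close> and eigenvalues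
  \<open>lam 0, \<dots>, lam (N - 1)\<close>; \<open>S\<close> and \<open>R\<close> are \<open>G\<close> to the powers \<open>1/2\<close> and \<open>-1/2\<close>.
\<close>

definition mpEDMD ::
  "nat \<Rightarrow> complex mat \<Rightarrow> complex mat \<Rightarrow> complex mat \<Rightarrow> complex mat \<Rightarrow> (nat \<Rightarrow> complex) \<Rightarrow> bool" where
  "mpEDMD N G A K V lam \<longleftrightarrow>
     (\<exists>S R U\<^sub>1 U\<^sub>2 V' (\<sigma> :: nat \<Rightarrow> real).
        positive_sqrt_mat N G S \<and>
        R \<in> carrier_mat N N \<and> inverts_mat R S \<and> inverts_mat S R \<and>
        unitary_mat N U\<^sub>1 \<and> unitary_mat N U\<^sub>2 \<and> (\<forall>i<N. 0 \<le> \<sigma> i) \<and>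
        R * mat_adjoint A * R = U\<^sub>1 * mat_diag N (\<lambda>i. complex_of_real (\<sigma> i)) * mat_adjoint U\<^sub>2 \<and>
        K = R * U\<^sub>2 * mat_adjoint U\<^sub>1 * S \<and>
        unitary_mat N V' \<and>
        U\<^sub>2 * mat_adjoint U\<^sub>1 = V' * mat_diag N lam * mat_adjoint V' \<and>
        V = R * V')"

text \<open>In \<open>v \<bullet>c u\<close> the second argument is conjugated: it is \<open>u\<^sup>*v\<close>.\<close>

definition mpEDMD_measure ::
  "nat \<Rightarrow> complex mat \<Rightarrow> complex mat \<Rightarrow> (nat \<Rightarrow> complex) \<Rightarrow> complex Matrix.vec \<Rightarrow> complex measure" where
  "mpEDMD_measure N G V lam c =
     measure_of (space circle) (sets circle)
       (\<lambda>U. ennreal (\<Sum>j | j < N \<and> lam j \<in> U. (cmod ((G *\<^sub>v c) \<bullet>c col V j))\<^sup>2))"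

section \<open>The Wasserstein distance\<close>

definition W1 :: "complex measure \<Rightarrow> complex measure \<Rightarrow> ereal" where
  "W1 \<mu> \<nu> =
     (SUP \<phi> \<in> {\<phi> :: complex \<Rightarrow> real. 1-lipschitz_on (sphere 0 1) \<phi>}.
        ereal ((\<integral>z. \<phi> z \<partial>\<mu>) - (\<integral>z. \<phi> z \<partial>\<nu>)))"

end

theory Submission
  imports Defs "HOL-Probability.Probability_Measure"
begin

text \<open>
  A 1-Lipschitz function on the circle is approximated within \<open>\<pi>/(L+1)\<close> by its convolution with
  the Fejer-Korovkin kernel \<open>|\<Sum> sin(k\<pi>/(L+1)) u\<^sup>k|\<^sup>2\<close>, a trigonometric polynomial of degree at most
  \<open>L\<close>. Convolving over the \<open>2(L+1)\<close>-th roots of unity instead of the circle loses nothing at this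
  degree and replaces integrals by finite sums. The coefficients of the polynomial decay like
  \<open>1/|l|\<close>, so its integrals against two probability measures differ by at most a constant times the
  weighted sum of the differences of their moments. For \<open>\<mu>\<^sub>g\<close> and \<open>\<mu>\<^sub>c\<close> these moments
  are \<open>\<langle>\<K>\<^sup>l g, g\<rangle>\<close> and \<open>c\<^sup>* G K\<^sup>l c\<close>. The spectral theorem is given through the first moment only;
  the higher ones follow because \<open>E(U)x\<close>, for a short arc \<open>U\<close>, is an approximate eigenvector.
\<close>

section \<open>Trigonometric approximation on roots of unity\<close>

text \<open>The sine weights come from an extremal problem: with p = L+1, the vector sin(k pi/p)
  vanishes at k = 0 and k = p and is the lowest eigenvector of the second difference with these
  boundary values. It therefore minimises the second moment of the kernel about its centre among
  weights vanishing at both ends, and that moment is at most (pi/p)^2. This gives an error O(1/L),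
  where the Fejer kernel would give log(L)/L; the logarithm of the statement enters only at the very
  end. Parseval would already hold with p nodes. With p nodes, however, the frequencies d and p - d
  alias and the decay 1/d of the coefficients is lost; with 2p nodes every frequency difference lies
  in the range where Jordan's inequality applies. On the spectral side no functional calculus is at
  hand. One first moment suffices because T is isometric and |z - \<zeta>|^2 = 2 - 2 Re(cnj \<zeta>
  z) on the circle: the squared norm of T u - \<zeta> u and the integral of |z - \<zeta>|^2 are the
  same expression in the first moment of u.\<close>

lemma sin_ge_linear:
  fixes x :: real
  assumes "0 \<le> x" "x \<le> pi / 2"
  shows "2 / pi * x \<le> sin x"
proof -
  have "convex_on {0..pi/2} (\<lambda>x. - sin x)"
  proof (rule f''_ge0_imp_convex)
    show "DERIV (\<lambda>x. - sin x) x :> - cos x" for x :: real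
      by (auto intro!: derivative_eq_intros)
    show "DERIV (\<lambda>x. - cos x) x :> sin x" for x :: real
      by (auto intro!: derivative_eq_intros)
    show "0 \<le> sin x" if "x \<in> {0..pi/2}" for x :: real
      using that by (intro sin_ge_zero) (auto simp: pi_ge_zero intro: order_trans)
  qed simp
  from convex_onD[OF this, of "2 / pi * x" 0 "pi / 2"] assms show ?thesis
    by (simp add: field_simps)
qed

lemma cmod_one_minus_cis: "cmod (1 - cis t) = 2 * \<bar>sin (t / 2)\<bar>"
  using dist_exp_i_1[of t] by (simp add: norm_minus_commute cis_conv_exp)

lemma one_minus_cos_le: "2 - 2 * cos t \<le> (t::real)\<^sup>2"
proof -
  have "2 - 2 * cos t = (2 * sin (t / 2))\<^sup>2"
    using cos_double_sin[of "t/2"] by (simp add: power_mult_distrib)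
  also have "\<dots> \<le> \<bar>t\<bar>\<^sup>2"
    using abs_sin_x_le_abs_x[of "t/2"] by (subst abs_le_square_iff[symmetric]) auto
  finally show ?thesis by simp
qed

section \<open>Discrete Fourier analysis on roots of unity\<close>

lemma cmod_power2_sum:
  fixes a :: "nat \<Rightarrow> real" and u :: complex
  shows "complex_of_real ((cmod (\<Sum>k<p. of_real (a k) * u ^ k))\<^sup>2) =
    (\<Sum>j<p. \<Sum>k<p. of_real (a j * a k) * (u ^ j * cnj u ^ k))"
  by (simp only: complex_norm_square) (simp add: sum_product ac_simps)

lemma root_of_unity_power_sum:
  fixes w :: complex
  assumes "w ^ n = 1" "w \<noteq> 1"
  shows "(\<Sum>m<n. w ^ m) = 0"
  using geometric_sum[OF assms(2), of n] assms(1) by simp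

lemma cis_power_mult_cnj_power:
  "cis t ^ j * cnj (cis t) ^ k = cis ((real j - real k) * t)"
  by (simp add: cis_cnj Complex.DeMoivre cis_mult algebra_simps)

lemma cis_root_power [simp]: "n > 0 \<Longrightarrow> cis (2 * pi / real n) ^ n = 1"
  by (simp add: Complex.DeMoivre)

lemma discrete_orthogonality:
  fixes j k n :: nat
  defines "\<zeta> \<equiv> cis (2 * pi / real n)"
  assumes "j < n" "k < n"
  shows "(\<Sum>m<n. (cnj (\<zeta> ^ m)) ^ j * (\<zeta> ^ m) ^ k) = (if j = k then of_nat n else 0)"
proof -
  have n: "n > 0" using assms by auto
  define v where "v = \<zeta> ^ k * cnj \<zeta> ^ j"
  have *: "(cnj (\<zeta> ^ m)) ^ j * (\<zeta> ^ m) ^ k = v ^ m" for m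
    by (simp add: v_def power_mult_distrib flip: power_mult) (simp add: ac_simps)
  have vn: "v ^ n = 1"
  proof -
    have "v ^ n = (\<zeta> ^ n) ^ k * cnj (\<zeta> ^ n) ^ j"
      by (simp add: v_def power_mult_distrib flip: power_mult) (simp add: ac_simps)
    thus ?thesis using n by (simp add: \<zeta>_def)
  qed
  show ?thesis
  proof (cases "j = k")
    case True
    have "\<zeta> * cnj \<zeta> = 1" by (simp add: \<zeta>_def cis_cnj cis_mult)
    hence "v = 1" using True by (simp add: v_def flip: power_mult_distrib)
    thus ?thesis unfolding * using True by simp
  next
    case False
    have v: "v = cis ((real k - real j) * (2 * pi / real n))"
      unfolding v_def \<zeta>_def by (rule cis_power_mult_cnj_power)
    have "v \<noteq> 1"
    proof
      assume "v = 1"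
      hence "sin ((real k - real j) * (2 * pi / real n) / 2) = 0"
        using cmod_one_minus_cis[of "(real k - real j) * (2 * pi / real n)"] v by simp
      then obtain i :: int where "(real k - real j) * (2 * pi / real n) / 2 = of_int i * pi"
        using sin_zero_iff_int2 by blast
      hence "(real k - real j) / real n * pi = of_int i * pi" by simp
      hence "(real k - real j) / real n = of_int i" by (subst (asm) mult_cancel_right) simp
      hence "real k - real j = of_int i * real n" using n by (simp add: field_simps)
      hence "real_of_int (int k - int j) = real_of_int (i * int n)" by simp
      hence e: "int k - int j = i * int n" by (simp only: of_int_eq_iff)
      \<comment> \<open>Two exponents below \<open>n\<close> differ by less than \<open>n\<close>,
        so the only multiple of \<open>n\<close> they can differ by is 0.\<close>
      have "\<bar>int k - int j\<bar> < int n" using assms by linarith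
      hence "\<bar>i\<bar> * int n < 1 * int n" using e by (simp add: abs_mult)
      hence "i = 0" by (subst (asm) mult_less_cancel_right) auto
      thus False using e False by simp
    qed
    thus ?thesis unfolding * using False root_of_unity_power_sum[OF vn] by simp
  qed
qed

text \<open>Cross terms vanish by orthogonality because all exponents stay below \<open>n\<close>,
  whatever the rotation \<open>z\<close>. Applied to the weights it gives the total mass of the
  kernel, applied to their differences its second moment.\<close>

lemma discrete_parseval:
  fixes a :: "nat \<Rightarrow> real" and z :: complex and n p :: nat
  defines "\<zeta> \<equiv> cis (2 * pi / real n)"
  assumes "p \<le> n" "cmod z = 1"
  shows "(\<Sum>m<n. (cmod (\<Sum>k<p. of_real (a k) * (z * cnj (\<zeta> ^ m)) ^ k))\<^sup>2) = real n * (\<Sum>k<p. (a k)\<^sup>2)"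
proof -
  have zz: "z * cnj z = 1" using assms(3) by (simp add: complex_norm_square[symmetric])
  have "complex_of_real (\<Sum>m<n. (cmod (\<Sum>k<p. of_real (a k) * (z * cnj (\<zeta> ^ m)) ^ k))\<^sup>2) =
     (\<Sum>m<n. \<Sum>j<p. \<Sum>k<p. of_real (a j * a k) * (z ^ j * cnj z ^ k) * ((cnj (\<zeta> ^ m)) ^ j * (\<zeta> ^ m) ^ k))"
    unfolding of_real_sum cmod_power2_sum
    by (intro sum.cong refl) (simp add: power_mult_distrib ac_simps)
  also have "\<dots> = (\<Sum>j<p. \<Sum>k<p. of_real (a j * a k) * (z ^ j * cnj z ^ k) *
       (\<Sum>m<n. (cnj (\<zeta> ^ m)) ^ j * (\<zeta> ^ m) ^ k))"
    unfolding sum_distrib_left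
    by (subst sum.swap, rule sum.cong[OF refl], subst sum.swap, rule refl)
  also have "\<dots> = (\<Sum>j<p. \<Sum>k<p. if j = k then of_nat n * of_real ((a j)\<^sup>2) else 0)"
  proof (intro sum.cong refl, goal_cases)
    case (1 j k)
    hence "j < n" "k < n" using assms by auto
    moreover have "z ^ k * cnj z ^ k = 1" by (simp add: zz flip: power_mult_distrib)
    ultimately show ?case
      unfolding \<zeta>_def by (subst discrete_orthogonality) (auto simp: power2_eq_square)
  qed
  also have "\<dots> = complex_of_real (real n * (\<Sum>k<p. (a k)\<^sup>2))"
    by (simp add: sum_distrib_left)
  finally show ?thesis by (simp only: of_real_eq_iff)
qed

text \<open>Summation by parts for the eigenvalue equation of the second difference. The boundary
  term at \<open>p\<close> is kept so that the induction closes; it disappears where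
  \<open>s p = 0\<close>.\<close>

lemma three_term_difference_sum:
  fixes s :: "nat \<Rightarrow> real"
  assumes "s 0 = 0" "\<And>k. s (Suc (Suc k)) = 2 * c * s (Suc k) - s k"
  shows "(\<Sum>k<p. (s (Suc k) - s k)\<^sup>2) = (2 - 2 * c) * (\<Sum>k<p. (s k)\<^sup>2) + s p * (s p - 2 * c * s p + s (Suc p))"
  by (induction p) (simp_all add: assms algebra_simps power2_eq_square)


text \<open>Summation by parts moves the difference onto \<open>\<phi>\<close>: neighbouring nodes
  are at most pi/p apart, so the 2p increments total at most 2 pi. Jordan's inequality bounds the
  factor |1 - v| below by 2d/p with d = |j - k|; it applies since the angle d pi/(2p) is below
  pi/2.\<close>

lemma discrete_fourier_coefficient_bound:
  fixes \<phi> :: "complex \<Rightarrow> real" and j k p :: nat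
  defines "\<zeta> \<equiv> cis (pi / real p)"
  assumes lip: "1-lipschitz_on (sphere 0 1) \<phi>" and jk: "j < p" "k < p" "j \<noteq> k"
  shows "cmod (\<Sum>m<2 * p. of_real (\<phi> (\<zeta> ^ m)) * ((cnj (\<zeta> ^ m)) ^ j * (\<zeta> ^ m) ^ k))
    \<le> real (2 * p) * (pi / (2 * \<bar>real j - real k\<bar>))"
proof -
  have p: "p > 0" using jk by simp
  define v where "v = \<zeta> ^ k * cnj \<zeta> ^ j"
  have *: "(cnj (\<zeta> ^ m)) ^ j * (\<zeta> ^ m) ^ k = v ^ m" for m
    by (simp add: v_def power_mult_distrib flip: power_mult) (simp add: ac_simps)
  have root: "\<zeta> ^ (2 * p) = 1"
    using p by (simp add: \<zeta>_def Complex.DeMoivre)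
  have vn: "v ^ (2 * p) = 1"
  proof -
    have "v ^ (2 * p) = (\<zeta> ^ (2 * p)) ^ k * cnj (\<zeta> ^ (2 * p)) ^ j"
      by (simp add: v_def power_mult_distrib flip: power_mult) (simp add: ac_simps)
    thus ?thesis using root by simp
  qed
  have norm_zeta: "cmod (\<zeta> ^ m) = 1" for m by (simp add: \<zeta>_def norm_power)
  have norm_v: "cmod v = 1" by (simp add: v_def norm_mult norm_power \<zeta>_def)
  define f where "f m = complex_of_real (\<phi> (\<zeta> ^ m))" for m
  define S where "S = (\<Sum>m<2 * p. f m * v ^ m)"
  \<comment> \<open>Both the values of \<open>\<phi>\<close> at the nodes and the powers of
    \<open>v\<close> have period 2p, so shifting the index cyclically leaves the sum
    unchanged.\<close>
  have shift: "(\<Sum>m<2 * p. f (Suc m) * v ^ Suc m) = S"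
  proof -
    have "S + f (2 * p) * v ^ (2 * p) = f 0 * v ^ 0 + (\<Sum>m<2 * p. f (Suc m) * v ^ Suc m)"
      unfolding S_def by (subst sum.lessThan_Suc[symmetric], subst sum.lessThan_Suc_shift) simp
    moreover have "f (2 * p) = f 0" by (simp only: f_def root power_0)
    ultimately show ?thesis by (simp only: vn power_0) simp
  qed
  have "(1 - v) * S = (\<Sum>m<2 * p. f (Suc m) * v ^ Suc m) - v * (\<Sum>m<2 * p. f m * v ^ m)"
    unfolding shift by (simp add: S_def algebra_simps)
  also have "\<dots> = (\<Sum>m<2 * p. (f (Suc m) - f m) * v ^ Suc m)"
    by (simp add: sum_distrib_left sum_subtractf algebra_simps)
  finally have "cmod (1 - v) * cmod S = cmod (\<Sum>m<2 * p. (f (Suc m) - f m) * v ^ Suc m)"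
    by (metis norm_mult)
  also have "\<dots> \<le> (\<Sum>m<2 * p. pi / real p)"
  proof (rule sum_norm_le)
    fix m
    have "cmod ((f (Suc m) - f m) * v ^ Suc m) = \<bar>\<phi> (\<zeta> ^ Suc m) - \<phi> (\<zeta> ^ m)\<bar>"
      by (simp add: norm_mult norm_power norm_v f_def flip: of_real_diff)
    also have "\<dots> \<le> cmod (\<zeta> ^ Suc m - \<zeta> ^ m)"
      using lipschitz_onD[OF lip, of "\<zeta> ^ Suc m" "\<zeta> ^ m"] norm_zeta[of m] norm_zeta[of "Suc m"]
      by (simp add: dist_norm)
    also have "\<dots> = cmod (1 - \<zeta>)"
    proof -
      have "\<zeta> ^ Suc m - \<zeta> ^ m = \<zeta> ^ m * (\<zeta> - 1)" by (simp add: algebra_simps)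
      thus ?thesis by (simp only: norm_mult norm_zeta norm_minus_commute mult_1)
    qed
    also have "\<dots> \<le> pi / real p"
      using abs_sin_x_le_abs_x[of "pi / real p / 2"] p by (simp add: \<zeta>_def cmod_one_minus_cis)
    finally show "cmod ((f (Suc m) - f m) * v ^ Suc m) \<le> pi / real p" .
  qed
  also have "\<dots> = 2 * pi" using p by simp
  finally have 1: "cmod (1 - v) * cmod S \<le> 2 * pi" .
  define d where "d = \<bar>real j - real k\<bar>"
  have d: "0 < d" "d < real p" using jk by (auto simp: d_def)
  have v: "v = cis ((real k - real j) * (pi / real p))"
    unfolding v_def \<zeta>_def by (rule cis_power_mult_cnj_power)
  have "cmod (1 - v) = 2 * \<bar>sin ((real k - real j) * (pi / real p) / 2)\<bar>"
    by (simp only: v cmod_one_minus_cis)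
  also have "\<bar>sin ((real k - real j) * (pi / real p) / 2)\<bar> = \<bar>sin (d * (pi / real p) / 2)\<bar>"
  proof (cases "j < k")
    case False
    hence "real k - real j = - d" by (simp add: d_def)
    hence "(real k - real j) * (pi / real p) / 2 = - (d * (pi / real p) / 2)" by simp
    thus ?thesis by (simp only: sin_minus abs_minus_cancel)
  qed (simp add: d_def)
  also have "2 * \<dots> \<ge> 2 * (d / real p)"
  proof -
    have "d / real p \<le> sin (d * (pi / real p) / 2)"
      using sin_ge_linear[of "d * (pi / real p) / 2"] d p by (simp add: field_simps)
    thus ?thesis by simp
  qed
  finally have "2 * (d / real p) * cmod S \<le> cmod (1 - v) * cmod S"
    by (intro mult_right_mono) auto
  with 1 have "2 * (d / real p) * cmod S \<le> 2 * pi" by simp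
  hence "cmod S \<le> real p * pi / d" using d p by (simp add: field_simps)
  thus ?thesis unfolding * by (simp add: S_def f_def d_def)
qed

section \<open>The Fejer-Korovkin approximant\<close>

text \<open>By \<open>discrete_parseval\<close> the denominator is the sum of the kernel over all
  nodes, so this is a weighted mean of the values of \<open>\<phi>\<close> at the nodes. The degree
  is below \<open>p\<close>, which is why \<open>p = Suc L\<close> is taken later.\<close>

definition korovkin_approx :: "nat \<Rightarrow> (complex \<Rightarrow> real) \<Rightarrow> complex \<Rightarrow> real" where
  "korovkin_approx p \<phi> z =
    (\<Sum>m<2 * p. \<phi> (cis (pi / real p) ^ m) *
       (cmod (\<Sum>k<p. of_real (sin (real k * pi / real p)) * (z * cnj (cis (pi / real p) ^ m)) ^ k))\<^sup>2)
     / (real (2 * p) * (\<Sum>k<p. (sin (real k * pi / real p))\<^sup>2))"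

lemma korovkin_weight_pos:
  assumes "p \<ge> 2"
  shows "(\<Sum>k<p. (sin (real k * pi / real p))\<^sup>2) > 0"
proof -
  have "sin (pi / real p) > 0"
    using assms by (intro sin_gt_zero) (auto simp: field_simps)
  thus ?thesis
    using assms by (intro sum_pos2[of _ 1]) auto
qed

text \<open>The error is a weighted mean of differences of \<open>\<phi>\<close>, hence at most the
  mean distance from \<open>z\<close> to the nodes, and the mean squared distance is at most the
  square of pi/p.\<close>

lemma korovkin_approx_error:
  assumes lip: "1-lipschitz_on (sphere 0 1) \<phi>" and p: "p \<ge> 2" and z: "cmod z = 1"
  shows "\<bar>\<phi> z - korovkin_approx p \<phi> z\<bar> \<le> pi / p"
proof -
  define \<theta> where "\<theta> = pi / real p"
  define s where "s k = sin (real k * pi / real p)" for k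
  define \<zeta> where "\<zeta> = cis (pi / real p)"
  define Z where "Z = (\<Sum>k<p. (s k)\<^sup>2)"
  define J where "J m = (cmod (\<Sum>k<p. of_real (s k) * (z * cnj (\<zeta> ^ m)) ^ k))\<^sup>2" for m
  have \<theta>: "\<theta> > 0" using p by (simp add: \<theta>_def)
  have Z: "Z > 0" using korovkin_weight_pos[OF p] by (simp add: Z_def s_def)
  have \<zeta>: "\<zeta> = cis (2 * pi / real (2 * p))" by (simp add: \<zeta>_def)
  have norm_zeta: "cmod (\<zeta> ^ m) = 1" for m by (simp add: \<zeta>_def norm_power)
  have total: "(\<Sum>m<2 * p. J m) = real (2 * p) * Z"
    unfolding J_def Z_def \<zeta> by (rule discrete_parseval) (use z in auto)
  have s0: "s 0 = 0" and sp: "s p = 0" using p by (simp_all add: s_def)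
  have s_eq: "s k = sin (real k * \<theta>)" for k by (simp add: s_def \<theta>_def)
  have rec: "s (Suc (Suc k)) = 2 * cos \<theta> * s (Suc k) - s k" for k
  proof -
    have "s (Suc (Suc k)) = sin (real (Suc k) * \<theta> + \<theta>)" "s k = sin (real (Suc k) * \<theta> - \<theta>)"
      by (simp_all add: s_eq algebra_simps)
    thus ?thesis by (simp only: sin_add sin_diff s_eq) (simp add: algebra_simps)
  qed
  have moment: "(\<Sum>m<2 * p. (cmod (z - \<zeta> ^ m))\<^sup>2 * J m) \<le> real (2 * p) * Z * \<theta>\<^sup>2"
  proof -
    have eq: "(cmod (z - \<zeta> ^ m))\<^sup>2 * J m =
        (cmod (\<Sum>k<p. of_real (s (Suc k) - s k) * (z * cnj (\<zeta> ^ m)) ^ k))\<^sup>2" for m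
    proof -
      define u where "u = z * cnj (\<zeta> ^ m)"
      have nu: "cmod u = 1" unfolding u_def norm_mult complex_mod_cnj norm_zeta z by simp
      have uz: "u * \<zeta> ^ m = z"
        using norm_zeta[of m] by (simp add: u_def mult.assoc complex_norm_square[symmetric] mult.commute[of "cnj _"] flip: complex_cnj_power)
      have "z - \<zeta> ^ m = - ((1 - u) * \<zeta> ^ m)" by (simp add: algebra_simps uz)
      hence "cmod (z - \<zeta> ^ m) = cmod (1 - u)" by (simp only: norm_minus_cancel norm_mult norm_zeta)
      \<comment> \<open>Multiplication by 1 - u turns the coefficients into their differences. As
        \<open>s\<close> vanishes at 0 and at \<open>p\<close>, no boundary terms arise and the
        exponents stay below \<open>p\<close> after the unimodular factor \<open>u\<close> is split
        off.\<close>
      moreover have e: "(1 - u) * (\<Sum>k<p. of_real (s k) * u ^ k) =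
          u * (\<Sum>k<p. of_real (s (Suc k) - s k) * u ^ k)"
      proof -
        have "(\<Sum>k<p. of_real (s k) * u ^ k) = (\<Sum>k<Suc p. complex_of_real (s k) * u ^ k)"
          by (simp add: sp)
        also have "\<dots> = (\<Sum>k<p. of_real (s (Suc k)) * u ^ Suc k)"
          by (subst sum.lessThan_Suc_shift) (simp add: s0)
        finally show ?thesis
          by (simp add: algebra_simps sum_subtractf sum_distrib_left)
      qed
      moreover have "cmod (1 - u) * cmod (\<Sum>k<p. of_real (s k) * u ^ k) =
          cmod (\<Sum>k<p. of_real (s (Suc k) - s k) * u ^ k)"
        using arg_cong[OF e, of cmod] by (simp only: norm_mult nu mult_1)
      ultimately show ?thesis
        unfolding J_def u_def[symmetric] by (simp only: flip: power_mult_distrib)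
    qed
    have "(\<Sum>m<2 * p. (cmod (z - \<zeta> ^ m))\<^sup>2 * J m) = real (2 * p) * (\<Sum>k<p. (s (Suc k) - s k)\<^sup>2)"
      unfolding eq unfolding \<zeta> by (rule discrete_parseval) (use z in auto)
    also have "\<dots> = real (2 * p) * ((2 - 2 * cos \<theta>) * Z)"
      by (subst three_term_difference_sum[OF s0 rec]) (simp add: sp Z_def)
    also have "\<dots> \<le> real (2 * p) * (\<theta>\<^sup>2 * Z)"
      using Z one_minus_cos_le[of \<theta>] by (intro mult_left_mono mult_right_mono) auto
    finally show ?thesis by (simp add: ac_simps)
  qed
  have K: "korovkin_approx p \<phi> z = (\<Sum>m<2 * p. \<phi> (\<zeta> ^ m) * J m) / (2 * p * Z)"
    by (simp add: korovkin_approx_def J_def Z_def s_def \<zeta>_def)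
  have "\<phi> z - korovkin_approx p \<phi> z = (\<Sum>m<2 * p. (\<phi> z - \<phi> (\<zeta> ^ m)) * J m) / (2 * p * Z)"
  proof -
    have "(\<Sum>m<2 * p. (\<phi> z - \<phi> (\<zeta> ^ m)) * J m) = \<phi> z * (real (2 * p) * Z) - (\<Sum>m<2 * p. \<phi> (\<zeta> ^ m) * J m)"
      unfolding total[symmetric] by (simp only: left_diff_distrib sum_subtractf sum_distrib_left)
    thus ?thesis using Z p unfolding K by (simp add: diff_divide_distrib)
  qed
  also have "\<bar>\<dots>\<bar> \<le> (\<Sum>m<2 * p. (\<theta> / 2) * J m + 1 / (2 * \<theta>) * ((cmod (z - \<zeta> ^ m))\<^sup>2 * J m)) / (2 * p * Z)"
    unfolding abs_divide
  proof (intro frac_le order_trans[OF sum_abs] sum_mono sum_nonneg)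
    fix m
    define t where "t = cmod (z - \<zeta> ^ m)"
    have J0: "J m \<ge> 0" by (simp add: J_def)
    have "\<bar>\<phi> z - \<phi> (\<zeta> ^ m)\<bar> \<le> t"
      using lipschitz_onD[OF lip, of z "\<zeta> ^ m"] norm_zeta[of m] z by (simp add: dist_norm t_def)
    \<comment> \<open>Arithmetic-geometric mean, balanced at t = \<theta>. It trades the first
      absolute moment for the second; the two halves then add up to exactly \<theta>.\<close>
    also have "t \<le> \<theta> / 2 + 1 / (2 * \<theta>) * t\<^sup>2"
      using sum_squares_ge_zero[of "\<theta> - t" 0] \<theta> by (simp add: field_simps power2_eq_square)
    finally have "\<bar>\<phi> z - \<phi> (\<zeta> ^ m)\<bar> * J m \<le> (\<theta> / 2 + 1 / (2 * \<theta>) * t\<^sup>2) * J m"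
      using J0 by (rule mult_right_mono)
    thus "\<bar>(\<phi> z - \<phi> (\<zeta> ^ m)) * J m\<bar> \<le> (\<theta> / 2) * J m + 1 / (2 * \<theta>) * ((cmod (z - \<zeta> ^ m))\<^sup>2 * J m)"
      using J0 by (simp only: abs_mult abs_of_nonneg t_def distrib_right mult.assoc)
  qed (use Z p \<theta> in \<open>auto simp: J_def\<close>)
  also have "\<dots> = (\<theta> / 2 * (real (2 * p) * Z) + 1 / (2 * \<theta>) * (\<Sum>m<2 * p. (cmod (z - \<zeta> ^ m))\<^sup>2 * J m)) / (2 * p * Z)"
    by (simp only: sum.distrib total flip: sum_distrib_left)
  also have "\<dots> \<le> (\<theta> / 2 * (real (2 * p) * Z) + 1 / (2 * \<theta>) * (real (2 * p) * Z * \<theta>\<^sup>2)) / (2 * p * Z)"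
    using Z \<theta> moment by (intro divide_right_mono add_left_mono mult_left_mono) auto
  also have "\<dots> = \<theta>" using Z \<theta> p by (simp add: field_simps power2_eq_square)
  finally show ?thesis by (simp add: \<theta>_def)
qed

text \<open>Separates \<open>z\<close> from \<open>\<phi>\<close>: a coefficient is a product of two
  weights and a discrete Fourier coefficient of \<open>\<phi>\<close> at frequency k - j. The sum is
  left doubly indexed rather than collected by frequency, the form in which
  \<open>toeplitz_sum_le\<close> applies.\<close>

lemma korovkin_approx_expand:
  fixes \<phi> :: "complex \<Rightarrow> real"
  defines "\<zeta> \<equiv> \<lambda>p::nat. cis (pi / real p)"
  shows "complex_of_real (korovkin_approx p \<phi> z) =
    (\<Sum>j<p. \<Sum>k<p. of_real (sin (real j * pi / real p) * sin (real k * pi / real p)) *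
      (\<Sum>m<2 * p. of_real (\<phi> (\<zeta> p ^ m)) * ((cnj (\<zeta> p ^ m)) ^ j * (\<zeta> p ^ m) ^ k)) *
      (z ^ j * cnj z ^ k)) / of_real (real (2 * p) * (\<Sum>k<p. (sin (real k * pi / real p))\<^sup>2))"
proof -
  have "complex_of_real (\<Sum>m<2 * p. \<phi> (\<zeta> p ^ m) *
       (cmod (\<Sum>k<p. of_real (sin (real k * pi / real p)) * (z * cnj (\<zeta> p ^ m)) ^ k))\<^sup>2) =
     (\<Sum>m<2 * p. \<Sum>j<p. \<Sum>k<p. of_real (sin (real j * pi / real p) * sin (real k * pi / real p)) *
       (of_real (\<phi> (\<zeta> p ^ m)) * ((cnj (\<zeta> p ^ m)) ^ j * (\<zeta> p ^ m) ^ k)) * (z ^ j * cnj z ^ k))"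
    unfolding of_real_sum of_real_mult[of "\<phi> _"] cmod_power2_sum sum_distrib_left
    by (intro sum.cong refl) (simp add: power_mult_distrib ac_simps)
  also have "\<dots> = (\<Sum>j<p. \<Sum>k<p. of_real (sin (real j * pi / real p) * sin (real k * pi / real p)) *
      (\<Sum>m<2 * p. of_real (\<phi> (\<zeta> p ^ m)) * ((cnj (\<zeta> p ^ m)) ^ j * (\<zeta> p ^ m) ^ k)) *
      (z ^ j * cnj z ^ k))"
    unfolding sum_distrib_left sum_distrib_right
    by (subst sum.swap, rule sum.cong[OF refl], subst sum.swap, rule refl)
  finally show ?thesis
    unfolding korovkin_approx_def \<zeta>_def by (simp only: of_real_divide)
qed

section \<open>Wasserstein distance and moments\<close>

lemma space_circle: "space circle = sphere 0 1"
  by (simp add: circle_def space_restrict_space)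

lemma sets_circle: "sets circle = (\<inter>) (sphere 0 1) ` sets borel"
  by (simp add: circle_def sets_restrict_space)

lemma space_eq_sphere: "sets \<mu> = sets circle \<Longrightarrow> space \<mu> = sphere 0 1"
  using sets_eq_imp_space_eq[of \<mu> circle] by (simp add: space_circle)

lemma borel_measurable_circle:
  fixes f :: "complex \<Rightarrow> 'b::topological_space"
  assumes "sets \<mu> = sets circle" "continuous_on (sphere 0 1) f"
  shows "f \<in> borel_measurable \<mu>"
  using borel_measurable_continuous_on_restrict[OF assms(2)]
    measurable_cong_sets[of \<mu> "restrict_space borel (sphere 0 1)" borel borel] assms(1)
  by (auto simp: circle_def)

lemma integrable_circle:
  fixes f :: "complex \<Rightarrow> 'b::{banach, second_countable_topology}"
  assumes "finite_measure \<mu>" "sets \<mu> = sets circle" "continuous_on (sphere 0 1) f"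
  shows "integrable \<mu> f"
proof -
  have "bounded (f ` sphere 0 1)"
    by (intro compact_imp_bounded compact_continuous_image assms compact_sphere)
  then obtain B where "\<And>z. z \<in> sphere 0 1 \<Longrightarrow> norm (f z) \<le> B"
    by (metis bounded_iff imageI)
  hence "AE z in \<mu>. norm (f z) \<le> B"
    using space_eq_sphere[OF assms(2)] by (intro AE_I2) simp
  thus ?thesis
    using finite_measure.integrable_const_bound[OF assms(1), of f B]
      borel_measurable_circle[OF assms(2,3)] by blast
qed

lemma korovkin_approx_continuous: "continuous_on S (korovkin_approx p \<phi>)"
  unfolding korovkin_approx_def[abs_def] divide_inverse by (intro continuous_intros)

section \<open>Integrals of the approximant in terms of moments\<close>

lemma cnj_power_cancel:
  assumes "cmod z = 1"
  shows "z ^ j * cnj z ^ k = (if k \<le> j then z ^ (j - k) else cnj (z ^ (k - j)))"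
proof -
  have 1: "z ^ i * cnj z ^ i = 1" for i
    using assms by (simp add: complex_norm_square[symmetric] flip: power_mult_distrib)
  show ?thesis
  proof (cases "k \<le> j")
    case True
    then obtain i where "j = k + i" using le_Suc_ex by blast
    thus ?thesis using 1[of k] by (simp add: power_add mult.commute mult.left_commute)
  next
    case False
    then obtain i where "k = j + i" using le_Suc_ex nat_le_linear by blast
    thus ?thesis using 1[of j] False by (simp add: power_add flip: mult.assoc)
  qed
qed

text \<open>Schur's test. The natural-number expression \<open>(j - k) + (k - j)\<close> is |j - k|.
  In each row a distance l >= 1 occurs at most twice, once on either side of the diagonal, and |s j
  * s k| is split symmetrically into squares.\<close>

lemma toeplitz_sum_le:
  fixes s g :: "nat \<Rightarrow> real"
  assumes g: "\<And>l. g l \<ge> 0" "g 0 = 0"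
  shows "(\<Sum>j\<le>L. \<Sum>k\<le>L. \<bar>s j * s k\<bar> * g ((j - k) + (k - j))) \<le> 2 * (\<Sum>l=1..L. g l) * (\<Sum>j\<le>L. (s j)\<^sup>2)"
proof -
  define h where "h j k = g ((j - k) + (k - j))" for j k :: nat
  have h_sym: "h j k = h k j" for j k by (simp add: h_def add.commute)
  have h0: "h j k \<ge> 0" for j k by (simp add: h_def g)
  have row: "(\<Sum>k\<le>L. h j k) \<le> 2 * (\<Sum>l=1..L. g l)" if "j \<le> L" for j
  proof -
    have "(\<Sum>k\<le>L. h j k) = (\<Sum>k<j. h j k) + (\<Sum>k=j..L. h j k)"
      using that by (subst sum.union_disjoint[symmetric]) (auto intro!: sum.cong)
    also have "(\<Sum>k<j. h j k) = (\<Sum>l=1..j. g l)"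
      by (rule sum.reindex_bij_witness[of _ "\<lambda>l. j - l" "\<lambda>k. j - k"]) (auto simp: h_def)
    also have "\<dots> \<le> (\<Sum>l=1..L. g l)" using that g by (intro sum_mono2) auto
    also have "(\<Sum>k=j..L. h j k) = (\<Sum>l\<le>L - j. g l)"
      by (rule sum.reindex_bij_witness[of _ "\<lambda>l. j + l" "\<lambda>k. k - j"]) (use that in \<open>auto simp: h_def\<close>)
    also have "\<dots> = (\<Sum>l=1..L - j. g l)"
      using g(2) by (intro sum.mono_neutral_right) (auto simp: Suc_le_eq intro: Suc_leI)
    also have "\<dots> \<le> (\<Sum>l=1..L. g l)" using g by (intro sum_mono2) auto
    finally show ?thesis by simp
  qed
  have "(\<Sum>j\<le>L. \<Sum>k\<le>L. \<bar>s j * s k\<bar> * h j k) \<le> (\<Sum>j\<le>L. \<Sum>k\<le>L. ((s j)\<^sup>2 + (s k)\<^sup>2) / 2 * h j k)"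
  proof (intro sum_mono mult_right_mono h0)
    show "\<bar>s j * s k\<bar> \<le> ((s j)\<^sup>2 + (s k)\<^sup>2) / 2" for j k
      using sum_squares_bound[of "\<bar>s j\<bar>" "\<bar>s k\<bar>"] by (simp add: abs_mult)
  qed
  also have "\<dots> = ((\<Sum>j\<le>L. \<Sum>k\<le>L. (s j)\<^sup>2 * h j k) + (\<Sum>j\<le>L. \<Sum>k\<le>L. (s k)\<^sup>2 * h j k)) / 2"
    unfolding sum.distrib[symmetric] sum_divide_distrib
    by (intro sum.cong refl) (simp add: field_simps)
  also have "(\<Sum>j\<le>L. \<Sum>k\<le>L. (s k)\<^sup>2 * h j k) = (\<Sum>j\<le>L. \<Sum>k\<le>L. (s j)\<^sup>2 * h j k)"
    by (subst sum.swap) (simp add: h_sym)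
  also have "((\<Sum>j\<le>L. \<Sum>k\<le>L. (s j)\<^sup>2 * h j k) + (\<Sum>j\<le>L. \<Sum>k\<le>L. (s j)\<^sup>2 * h j k)) / 2 =
      (\<Sum>j\<le>L. (s j)\<^sup>2 * (\<Sum>k\<le>L. h j k))"
    by (simp only: sum_distrib_left) simp
  also have "\<dots> \<le> (\<Sum>j\<le>L. (s j)\<^sup>2 * (2 * (\<Sum>l=1..L. g l)))"
    by (intro sum_mono mult_left_mono row) auto
  also have "\<dots> = 2 * (\<Sum>l=1..L. g l) * (\<Sum>j\<le>L. (s j)\<^sup>2)"
    by (simp add: sum_distrib_left[symmetric] sum_distrib_right[symmetric])
  finally show ?thesis by (simp add: h_def)
qed

text \<open>On the circle a negative power is the conjugate of a positive one, so moments of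
  nonnegative order control all frequencies.\<close>

lemma cmod_moment_diff:
  assumes "finite_measure \<mu>" "sets \<mu> = sets circle" "finite_measure \<nu>" "sets \<nu> = sets circle"
  shows "cmod ((\<integral>z. z ^ j * cnj z ^ k \<partial>\<mu>) - (\<integral>z. z ^ j * cnj z ^ k \<partial>\<nu>)) =
    cmod ((\<integral>z. z ^ ((j - k) + (k - j)) \<partial>\<mu>) - (\<integral>z. z ^ ((j - k) + (k - j)) \<partial>\<nu>))"
proof -
  have eq: "(\<integral>z. z ^ j * cnj z ^ k \<partial>\<xi>) =
      (if k \<le> j then \<integral>z. z ^ (j - k) \<partial>\<xi> else cnj (\<integral>z. z ^ (k - j) \<partial>\<xi>))"
    if "sets \<xi> = sets circle" for \<xi> :: "complex measure"
  proof -
    have "(\<integral>z. z ^ j * cnj z ^ k \<partial>\<xi>) = (\<integral>z. (if k \<le> j then z ^ (j - k) else cnj (z ^ (k - j))) \<partial>\<xi>)"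
      using space_eq_sphere[OF that] by (intro Bochner_Integration.integral_cong refl cnj_power_cancel) auto
    thus ?thesis by (simp del: complex_cnj_power)
  qed
  show ?thesis
    unfolding eq[OF assms(2)] eq[OF assms(4)]
    by (cases "k \<le> j") (simp_all flip: complex_cnj_diff)
qed

text \<open>The factor 2p from the Fourier coefficients and the factor \<open>Z\<close> from Schur's
  test cancel against the normalisation of the kernel, so the constant pi is independent of
  \<open>L\<close>.\<close>

lemma korovkin_approx_integral_diff:
  fixes \<mu> \<nu> :: "complex measure"
  assumes "prob_space \<mu>" "sets \<mu> = sets circle" "prob_space \<nu>" "sets \<nu> = sets circle"
    and lip: "1-lipschitz_on (sphere 0 1) \<phi>" and L: "L \<ge> 1"
  shows "\<bar>(\<integral>z. korovkin_approx (Suc L) \<phi> z \<partial>\<mu>) - (\<integral>z. korovkin_approx (Suc L) \<phi> z \<partial>\<nu>)\<bar>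
    \<le> pi * (\<Sum>l=1..L. cmod ((\<integral>z. z ^ l \<partial>\<mu>) - (\<integral>z. z ^ l \<partial>\<nu>)) / real l)"
proof -
  interpret \<mu>: prob_space \<mu> by fact
  interpret \<nu>: prob_space \<nu> by fact
  define p where "p = Suc L"
  define s where "s k = sin (real k * pi / real p)" for k
  define Z where "Z = (\<Sum>k\<le>L. (s k)\<^sup>2)"
  have Z: "Z > 0"
    using korovkin_weight_pos[of p] L by (simp add: Z_def s_def p_def lessThan_Suc_atMost)
  define \<zeta> where "\<zeta> = cis (pi / real p)"
  define S where "S j k = (\<Sum>m<2 * p. complex_of_real (\<phi> (\<zeta> ^ m)) * ((cnj (\<zeta> ^ m)) ^ j * (\<zeta> ^ m) ^ k))" for j k
  define c where "c j k = complex_of_real (s j * s k) * S j k" for j k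
  define D where "D j k = (\<integral>z. z ^ j * cnj z ^ k \<partial>\<mu>) - (\<integral>z. z ^ j * cnj z ^ k \<partial>\<nu>)" for j k
  \<comment> \<open>Division by zero yields 0, so \<open>g 0 = 0\<close> as
    \<open>toeplitz_sum_le\<close> requires.\<close>
  define g where "g l = cmod ((\<integral>z. z ^ l \<partial>\<mu>) - (\<integral>z. z ^ l \<partial>\<nu>)) / real l" for l
  have expand: "complex_of_real (korovkin_approx p \<phi> z) =
      (\<Sum>j\<le>L. \<Sum>k\<le>L. c j k * (z ^ j * cnj z ^ k)) / of_real (2 * p * Z)" for z
    unfolding korovkin_approx_expand c_def S_def s_def Z_def \<zeta>_def
    by (simp only: p_def lessThan_Suc_atMost)
  have int: "complex_of_real (\<integral>z. korovkin_approx p \<phi> z \<partial>\<xi>) =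
      (\<Sum>j\<le>L. \<Sum>k\<le>L. c j k * (\<integral>z. z ^ j * cnj z ^ k \<partial>\<xi>)) / of_real (2 * p * Z)"
    if \<xi>: "finite_measure \<xi>" "sets \<xi> = sets circle" for \<xi> :: "complex measure"
  proof -
    have i: "integrable \<xi> (\<lambda>z. z ^ j * cnj z ^ k)" for j k
      by (intro integrable_circle \<xi> continuous_intros)
    show ?thesis
      unfolding integral_complex_of_real[symmetric] expand
      by (simp add: i Bochner_Integration.integral_sum)
  qed
  have D: "cmod (D j k) = cmod ((\<integral>z. z ^ ((j - k) + (k - j)) \<partial>\<mu>) - (\<integral>z. z ^ ((j - k) + (k - j)) \<partial>\<nu>))" for j k
    unfolding D_def by (rule cmod_moment_diff) (use assms \<mu>.finite_measure_axioms \<nu>.finite_measure_axioms in auto)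
  have e: "complex_of_real ((\<integral>z. korovkin_approx p \<phi> z \<partial>\<mu>) - (\<integral>z. korovkin_approx p \<phi> z \<partial>\<nu>)) =
      (\<Sum>j\<le>L. \<Sum>k\<le>L. c j k * D j k) / of_real (2 * p * Z)"
    unfolding of_real_diff int[OF \<mu>.finite_measure_axioms assms(2)] int[OF \<nu>.finite_measure_axioms assms(4)]
    by (simp add: D_def sum_subtractf algebra_simps flip: diff_divide_distrib)
  have "\<bar>(\<integral>z. korovkin_approx p \<phi> z \<partial>\<mu>) - (\<integral>z. korovkin_approx p \<phi> z \<partial>\<nu>)\<bar> =
      cmod (\<Sum>j\<le>L. \<Sum>k\<le>L. c j k * D j k) / \<bar>2 * p * Z\<bar>"
    using arg_cong[OF e, of cmod] by (simp only: norm_of_real norm_divide)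
  also have "\<bar>2 * p * Z\<bar> = 2 * p * Z" using Z by simp
  also have "cmod (\<Sum>j\<le>L. \<Sum>k\<le>L. c j k * D j k) / (2 * p * Z) \<le>
      (\<Sum>j\<le>L. \<Sum>k\<le>L. (p * pi) * (\<bar>s j * s k\<bar> * g ((j - k) + (k - j)))) / (2 * p * Z)"
  proof (intro divide_right_mono sum_norm_le)
    fix j k assume jk: "j \<in> {..L}" "k \<in> {..L}"
    show "cmod (c j k * D j k) \<le> (p * pi) * (\<bar>s j * s k\<bar> * g ((j - k) + (k - j)))"
    proof (cases "j = k")
      case True
      \<comment> \<open>The diagonal carries frequency 0, where the moments are the total masses,
        both equal to 1.\<close>
      hence "cmod (D j k) = 0" unfolding D by (simp add: \<mu>.prob_space \<nu>.prob_space)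
      thus ?thesis using True by (simp add: g_def norm_mult)
    next
      case False
      have d: "\<bar>real j - real k\<bar> = real ((j - k) + (k - j))" by auto
      have "cmod (S j k) \<le> real (2 * p) * (pi / (2 * \<bar>real j - real k\<bar>))"
        unfolding S_def \<zeta>_def
        by (rule discrete_fourier_coefficient_bound[OF lip]) (use jk False in \<open>auto simp: p_def\<close>)
      hence "\<bar>s j * s k\<bar> * cmod (S j k) * cmod (D j k) \<le>
         \<bar>s j * s k\<bar> * (real (2 * p) * (pi / (2 * \<bar>real j - real k\<bar>))) * cmod (D j k)"
        by (intro mult_right_mono mult_left_mono) auto
      also have "\<dots> = (p * pi) * (\<bar>s j * s k\<bar> * g ((j - k) + (k - j)))"
        unfolding d g_def D[symmetric] by (simp del: of_nat_add)
      finally show ?thesis unfolding c_def norm_mult norm_of_real .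
    qed
  qed (use Z in simp)
  also have "\<dots> = (p * pi) * (\<Sum>j\<le>L. \<Sum>k\<le>L. \<bar>s j * s k\<bar> * g ((j - k) + (k - j))) / (2 * p * Z)"
    by (simp only: sum_distrib_left)
  also have "\<dots> \<le> (p * pi) * (2 * (\<Sum>l=1..L. g l) * Z) / (2 * p * Z)"
    unfolding Z_def
    by (intro divide_right_mono mult_left_mono toeplitz_sum_le) (auto simp: g_def sum_nonneg)
  also have "\<dots> = pi * (\<Sum>l=1..L. g l)" using Z by (simp add: field_simps) (simp add: p_def)
  finally show ?thesis by (simp add: p_def g_def)
qed

text \<open>The approximation error pi/(L+1) is paid once for each measure, uniformly over the test
  functions.\<close>

lemma W1_moment_bound:
  fixes \<mu> \<nu> :: "complex measure"
  assumes \<mu>: "prob_space \<mu>" "sets \<mu> = sets circle" and \<nu>: "prob_space \<nu>" "sets \<nu> = sets circle"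
    and L: "L \<ge> 1"
  shows "W1 \<mu> \<nu> \<le> ereal (2 * pi / real (Suc L) +
    pi * (\<Sum>l=1..L. cmod ((\<integral>z. z ^ l \<partial>\<mu>) - (\<integral>z. z ^ l \<partial>\<nu>)) / real l))"
  unfolding W1_def
proof (rule SUP_least, clarify)
  fix \<phi> :: "complex \<Rightarrow> real" assume lip: "1-lipschitz_on (sphere 0 1) \<phi>"
  let ?T = "korovkin_approx (Suc L) \<phi>"
  have err: "\<bar>(\<integral>z. \<phi> z \<partial>\<xi>) - (\<integral>z. ?T z \<partial>\<xi>)\<bar> \<le> pi / real (Suc L)"
    if "prob_space \<xi>" "sets \<xi> = sets circle" for \<xi> :: "complex measure"
  proof -
    interpret prob_space \<xi> by fact
    have i: "integrable \<xi> \<phi>" "integrable \<xi> ?T"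
      using finite_measure_axioms that(2)
      by (auto intro!: integrable_circle korovkin_approx_continuous lipschitz_on_continuous_on[OF lip])
    have "\<bar>(\<integral>z. \<phi> z \<partial>\<xi>) - (\<integral>z. ?T z \<partial>\<xi>)\<bar> = \<bar>\<integral>z. \<phi> z - ?T z \<partial>\<xi>\<bar>"
      using i by simp
    also have "\<dots> \<le> (\<integral>z. \<bar>\<phi> z - ?T z\<bar> \<partial>\<xi>)"
      by (rule integral_abs_bound)
    also have "\<dots> \<le> (\<integral>z. pi / real (Suc L) \<partial>\<xi>)"
    proof (rule integral_mono)
      show "\<bar>\<phi> z - ?T z\<bar> \<le> pi / real (Suc L)" if "z \<in> space \<xi>" for z
        using that L space_eq_sphere[OF \<open>sets \<xi> = sets circle\<close>]
        by (intro korovkin_approx_error[OF lip]) auto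
    qed (use i in auto)
    finally show ?thesis by (simp add: prob_space)
  qed
  have "(\<integral>z. \<phi> z \<partial>\<mu>) - (\<integral>z. \<phi> z \<partial>\<nu>) \<le> 2 * pi / real (Suc L) +
    pi * (\<Sum>l=1..L. cmod ((\<integral>z. z ^ l \<partial>\<mu>) - (\<integral>z. z ^ l \<partial>\<nu>)) / real l)"
    using err[OF \<mu>] err[OF \<nu>] korovkin_approx_integral_diff[OF \<mu> \<nu> lip L] by (simp add: abs_le_iff)
  thus "ereal ((\<integral>z. \<phi> z \<partial>\<mu>) - (\<integral>z. \<phi> z \<partial>\<nu>)) \<le> ereal (2 * pi / real (Suc L) +
    pi * (\<Sum>l=1..L. cmod ((\<integral>z. z ^ l \<partial>\<mu>) - (\<integral>z. z ^ l \<partial>\<nu>)) / real l))"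
    by simp
qed

section \<open>Moments of spectral measures of unitary operators\<close>

locale complex_hilbert_space =
  fixes H :: "'h inner_space"
  assumes hilbert_space: "hilbert_space H"
begin

sublocale Module.module "class_ring :: complex ring" H
  using hilbert_space unfolding hilbert_space_def by blast

abbreviation ip :: "'h \<Rightarrow> 'h \<Rightarrow> complex" where "ip \<equiv> hinner H"

definition nrm :: "'h \<Rightarrow> real" where "nrm x = sqrt (Re (ip x x))"

lemma smult_carrier [simp, intro]: "x \<in> carrier H \<Longrightarrow> c \<odot>\<^bsub>H\<^esub> x \<in> carrier H"
  by (rule smult_closed) (auto simp: class_ring_simps)

lemma ip_add_left: "x \<in> carrier H \<Longrightarrow> y \<in> carrier H \<Longrightarrow> z \<in> carrier H \<Longrightarrow> ip (x \<oplus>\<^bsub>H\<^esub> y) z = ip x z + ip y z"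
  using hilbert_space unfolding hilbert_space_def by blast

lemma ip_smult_left: "x \<in> carrier H \<Longrightarrow> y \<in> carrier H \<Longrightarrow> ip (c \<odot>\<^bsub>H\<^esub> x) y = c * ip x y"
  using hilbert_space unfolding hilbert_space_def by blast

lemma ip_cnj: "x \<in> carrier H \<Longrightarrow> y \<in> carrier H \<Longrightarrow> ip y x = cnj (ip x y)"
  using hilbert_space unfolding hilbert_space_def by blast

lemma ip_add_right: "x \<in> carrier H \<Longrightarrow> y \<in> carrier H \<Longrightarrow> z \<in> carrier H \<Longrightarrow> ip z (x \<oplus>\<^bsub>H\<^esub> y) = ip z x + ip z y"
  by (subst (1 2 3) ip_cnj) (auto simp: ip_add_left)

lemma ip_smult_right: "x \<in> carrier H \<Longrightarrow> y \<in> carrier H \<Longrightarrow> ip y (c \<odot>\<^bsub>H\<^esub> x) = cnj c * ip y x"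
  by (subst (1 2) ip_cnj) (auto simp: ip_smult_left)

lemma ip_zero_left: "y \<in> carrier H \<Longrightarrow> ip \<zero>\<^bsub>H\<^esub> y = 0"
  using ip_add_left[of "\<zero>\<^bsub>H\<^esub>" "\<zero>\<^bsub>H\<^esub>" y] by simp

lemma ip_minus_left:
  assumes "x \<in> carrier H" "y \<in> carrier H" "z \<in> carrier H"
  shows "ip (x \<ominus>\<^bsub>H\<^esub> y) z = ip x z - ip y z"
proof -
  have "(x \<ominus>\<^bsub>H\<^esub> y) \<oplus>\<^bsub>H\<^esub> y = x"
    unfolding a_minus_def using assms by (subst M.a_assoc) (auto simp: M.l_neg)
  hence "ip x z = ip ((x \<ominus>\<^bsub>H\<^esub> y) \<oplus>\<^bsub>H\<^esub> y) z" by simp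
  thus ?thesis using assms by (simp add: ip_add_left)
qed

lemma ip_nonneg: "x \<in> carrier H \<Longrightarrow> 0 \<le> Re (ip x x)"
  using hilbert_space unfolding hilbert_space_def by blast

lemma ip_self_real: "x \<in> carrier H \<Longrightarrow> ip x x = complex_of_real (Re (ip x x))"
  using ip_cnj[of x x] by (simp add: complex_eq_iff)

lemma ip_definite: "x \<in> carrier H \<Longrightarrow> ip x x = 0 \<Longrightarrow> x = \<zero>\<^bsub>H\<^esub>"
  using hilbert_space unfolding hilbert_space_def by blast

lemma nrm_nonneg: "x \<in> carrier H \<Longrightarrow> 0 \<le> nrm x"
  by (simp add: nrm_def ip_nonneg)

lemma nrm_power2: "x \<in> carrier H \<Longrightarrow> (nrm x)\<^sup>2 = Re (ip x x)"
  by (simp add: nrm_def ip_nonneg)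

lemma Cauchy_Schwarz:
  assumes x: "x \<in> carrier H" and y: "y \<in> carrier H"
  shows "cmod (ip x y) \<le> nrm x * nrm y"
proof -
  define a b c where "a = Re (ip x x)" "b = Re (ip y y)" "c = ip x y"
  have a: "ip x x = of_real a" and b: "ip y y = of_real b"
    using ip_self_real x y by (auto simp: a_b_c_def)
  have c': "ip y x = cnj c" using ip_cnj[OF x y] by (simp add: a_b_c_def)
  have "(cmod c)\<^sup>2 \<le> a * b"
  proof (cases "b = 0")
    case True
    hence "y = \<zero>\<^bsub>H\<^esub>" using ip_definite[OF y] b by simp
    hence "c = 0" using ip_zero_left[OF x] c' by simp
    thus ?thesis using True by simp
  next
    case False
    hence b0: "b > 0" using ip_nonneg[OF y] by (simp add: a_b_c_def)
    \<comment> \<open>A multiple of the component of \<open>x\<close> orthogonal to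
      \<open>y\<close>, scaled by \<open>b\<close> to avoid division.\<close>
    define v where "v = (of_real b \<odot>\<^bsub>H\<^esub> x) \<oplus>\<^bsub>H\<^esub> ((- c) \<odot>\<^bsub>H\<^esub> y)"
    have "ip v v = of_real b * of_real b * of_real a - of_real b * (c * cnj c)"
      using x y by (simp add: v_def ip_add_left ip_add_right ip_smult_left ip_smult_right a b c' a_b_c_def(3)[symmetric] algebra_simps)
    also have "\<dots> = of_real (b * (a * b - (cmod c)\<^sup>2))"
      by (simp only: complex_norm_square of_real_mult of_real_diff) (simp add: algebra_simps)
    finally have "ip v v = of_real (b * (a * b - (cmod c)\<^sup>2))" .
    moreover have "0 \<le> Re (ip v v)" using x y by (intro ip_nonneg) (auto simp: v_def)
    ultimately have "0 \<le> b * (a * b - (cmod c)\<^sup>2)" by simp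
    thus ?thesis using b0 by (simp add: zero_le_mult_iff)
  qed
  hence "sqrt ((cmod c)\<^sup>2) \<le> sqrt (a * b)" by (rule real_sqrt_le_mono)
  thus ?thesis by (simp add: nrm_def a_b_c_def real_sqrt_mult)
qed

end

section \<open>Scalar measures of a projection-valued measure\<close>

text \<open>The operators and the underlying spaces may differ, which lets a measure formed in L2 be
  identified with one formed in the extension space.\<close>

lemma scalar_spectral_measure_cong:
  assumes "\<And>U. U \<in> sets circle \<Longrightarrow> ip (E U x) x = ip' (E' U x') x'"
  shows "scalar_spectral_measure ip E x = scalar_spectral_measure ip' E' x'"
  unfolding scalar_spectral_measure_def
  by (rule measure_of_eq) (use assms sets.sigma_sets_eq[of circle] sets.space_closed[of circle] in auto)

lemma sets_scalar_spectral_measure [simp]: "sets (scalar_spectral_measure ip E x) = sets circle"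
  unfolding scalar_spectral_measure_def
  by (subst sets_measure_of) (use sets.sigma_sets_eq[of circle] sets.space_closed[of circle] in auto)

locale hilbert_pvm = complex_hilbert_space H for H :: "'h inner_space" +
  fixes E :: "complex set \<Rightarrow> 'h \<Rightarrow> 'h"
  assumes pvm: "projection_valued_measure H E"
begin

abbreviation sm :: "'h \<Rightarrow> complex measure" where "sm \<equiv> scalar_spectral_measure ip E"

lemma E_carrier: "U \<in> sets circle \<Longrightarrow> x \<in> carrier H \<Longrightarrow> E U x \<in> carrier H"
  using pvm by (auto simp: projection_valued_measure_def selfadjoint_projection_def linear_operator_def)

lemma E_empty: "x \<in> carrier H \<Longrightarrow> E {} x = \<zero>\<^bsub>H\<^esub>"
  using pvm by (simp add: projection_valued_measure_def)

lemma E_space: "x \<in> carrier H \<Longrightarrow> E (space circle) x = x"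
  using pvm by (simp add: projection_valued_measure_def)

lemma E_Int: "U \<in> sets circle \<Longrightarrow> V \<in> sets circle \<Longrightarrow> x \<in> carrier H \<Longrightarrow> E U (E V x) = E (U \<inter> V) x"
  using pvm by (simp add: projection_valued_measure_def)

lemma E_sums:
  "range A \<subseteq> sets circle \<Longrightarrow> disjoint_family A \<Longrightarrow> x \<in> carrier H \<Longrightarrow> y \<in> carrier H \<Longrightarrow>
     (\<lambda>n. ip (E (A n) x) y) sums ip (E (\<Union>n. A n) x) y" for A :: "nat \<Rightarrow> complex set"
  using pvm unfolding projection_valued_measure_def by blast

lemma ip_E_self:
  assumes "U \<in> sets circle" "x \<in> carrier H"
  shows "ip (E U x) x = of_real ((nrm (E U x))\<^sup>2)"
proof -
  have "ip (E U x) x = ip (E U (E U x)) x" using E_Int[of U U x] assms by simp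
  also have "\<dots> = ip (E U x) (E U x)"
    using pvm assms E_carrier
    by (auto simp: projection_valued_measure_def selfadjoint_projection_def)
  also have "\<dots> = of_real ((nrm (E U x))\<^sup>2)"
    using ip_self_real[of "E U x"] nrm_power2[of "E U x"] E_carrier[OF assms] by simp
  finally show ?thesis .
qed

text \<open>\<open>measure_of\<close> falls back on the zero measure unless its argument is positive
  and countably additive. Both follow from the axioms for \<open>E\<close>, as each
  \<open>ip (E U x) x\<close> is a squared norm.\<close>

lemma emeasure_sm:
  assumes U: "U \<in> sets circle" and x: "x \<in> carrier H"
  shows "emeasure (sm x) U = ennreal ((nrm (E U x))\<^sup>2)"
proof -
  have "emeasure (sm x) U = ennreal (Re (ip (E U x) x))"
    unfolding scalar_spectral_measure_def
  proof (rule emeasure_measure_of_sigma)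
    show "sigma_algebra (space circle) (sets circle)" ..
    show "positive (sets circle) (\<lambda>U. ennreal (Re (ip (E U x) x)))"
      using x by (simp add: positive_def E_empty ip_zero_left)
    show "countably_additive (sets circle) (\<lambda>U. ennreal (Re (ip (E U x) x)))"
    proof (rule countably_additiveI)
      fix A :: "nat \<Rightarrow> complex set"
      assume A: "range A \<subseteq> sets circle" "disjoint_family A" "\<Union> (range A) \<in> sets circle"
      have "(\<lambda>n. Re (ip (E (A n) x) x)) sums Re (ip (E (\<Union>n. A n) x) x)"
        using sums_Re[OF E_sums[OF A(1,2) x x]] .
      moreover have "0 \<le> Re (ip (E V x) x)" if "V \<in> sets circle" for V
        using ip_E_self[OF that x] by simp
      ultimately have "(\<lambda>n. ennreal (Re (ip (E (A n) x) x))) sums ennreal (Re (ip (E (\<Union>n. A n) x) x))"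
        using A by (subst sums_ennreal) auto
      thus "(\<Sum>n. ennreal (Re (ip (E (A n) x) x))) = ennreal (Re (ip (E (\<Union> (range A)) x) x))"
        by (rule sums_unique[symmetric])
    qed
  qed (fact U)
  thus ?thesis using ip_E_self[OF U x] by simp
qed

lemma measure_sm:
  assumes "U \<in> sets circle" "x \<in> carrier H"
  shows "measure (sm x) U = (nrm (E U x))\<^sup>2"
  using emeasure_sm[OF assms] by (simp add: measure_def)

lemma space_sm: "space (sm x) = sphere 0 1"
  by (rule space_eq_sphere) simp

lemma finite_measure_sm: "x \<in> carrier H \<Longrightarrow> finite_measure (sm x)"
  by (rule finite_measureI) (simp add: space_sm emeasure_sm flip: space_circle)

lemma measure_sm_space: "x \<in> carrier H \<Longrightarrow> measure (sm x) (sphere 0 1) = (nrm x)\<^sup>2"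
  using measure_sm[OF sets.top, of x] E_space[of x] by (simp only: space_circle)

text \<open>The complement of \<open>U\<close> has measure zero because its projection annihilates
  the range of \<open>E U\<close>.\<close>

lemma AE_sm_range:
  assumes "U \<in> sets circle" "x \<in> carrier H"
  shows "AE z in sm (E U x). z \<in> U"
proof (rule AE_I)
  have c: "space circle - U \<in> sets circle" using assms by auto
  show "{z \<in> space (sm (E U x)). z \<notin> U} \<subseteq> space circle - U" by (auto simp: space_sm space_circle)
  show "space circle - U \<in> sets (sm (E U x))" using c by simp
  have "E (space circle - U) (E U x) = \<zero>\<^bsub>H\<^esub>"
    using E_Int[OF c assms] E_empty[OF assms(2)] by (simp only: Int_commute[of _ U] Diff_disjoint)
  thus "emeasure (sm (E U x)) (space circle - U) = 0"
    using emeasure_sm[OF c E_carrier[OF assms]] ip_zero_left[OF M.zero_closed] by (simp add: nrm_def)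
qed

end

section \<open>Approximate eigenvectors of a unitary operator\<close>

locale hilbert_spectral = hilbert_pvm H E for H :: "'h inner_space" and E +
  fixes T :: "'h \<Rightarrow> 'h"
  assumes unitary: "unitary_operator H T"
    and spectral: "spectral_measure_of H T E"
begin

lemma T_carrier: "x \<in> carrier H \<Longrightarrow> T x \<in> carrier H"
  using unitary by (auto simp: unitary_operator_def linear_operator_def)

lemma T_pow_carrier: "x \<in> carrier H \<Longrightarrow> (T ^^ l) x \<in> carrier H"
  by (induction l) (auto simp: T_carrier)

lemma T_isometry: "x \<in> carrier H \<Longrightarrow> y \<in> carrier H \<Longrightarrow> ip (T x) (T y) = ip x y"
  using unitary by (simp add: unitary_operator_def)

lemma T_pow_isometry: "x \<in> carrier H \<Longrightarrow> y \<in> carrier H \<Longrightarrow> ip ((T ^^ l) x) ((T ^^ l) y) = ip x y"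
  by (induction l) (auto simp: T_isometry T_pow_carrier)

lemma nrm_T: "x \<in> carrier H \<Longrightarrow> nrm (T x) = nrm x"
  by (simp add: nrm_def T_isometry)

text \<open>Surjectivity takes the place of an adjoint: \<open>T\<close> is moved across the inner
  product by writing the other argument as an image under \<open>T\<close>.\<close>

lemma T_surj:
  assumes "y \<in> carrier H" obtains y' where "y' \<in> carrier H" "y = T y'"
  using assms unitary unfolding unitary_operator_def bij_betw_def by blast

lemma T_pow_surj:
  assumes "y \<in> carrier H" obtains y' where "y' \<in> carrier H" "y = (T ^^ l) y'"
proof -
  have "\<exists>y'\<in>carrier H. y = (T ^^ l) y'"
    using assms
  proof (induction l arbitrary: y)
    case (Suc l)
    obtain y1 where y1: "y1 \<in> carrier H" "y = T y1" using T_surj[OF Suc.prems] .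
    with Suc.IH[of y1] show ?case by auto
  qed auto
  thus thesis using that by blast
qed

lemma first_moment: "x \<in> carrier H \<Longrightarrow> ip (T x) x = (\<integral>z. z \<partial>sm x)"
  using spectral by (simp add: spectral_measure_of_def)

text \<open>With d = T u - \<zeta> u, isometry gives |d|^2 = 2|u|^2 - 2 Re(cnj \<zeta> <T u, u>),
  and the first moment identifies this with the integral of |z - \<zeta>|^2 against the measure of
  \<open>u\<close>. That measure lives on \<open>U\<close>, where the integrand is at most
  \<epsilon>^2. The weak form, tested against \<open>y\<close>, is what the induction on powers
  uses.\<close>

lemma approx_eigenvector:
  assumes U: "U \<in> sets circle" and x: "x \<in> carrier H" and y: "y \<in> carrier H"
    and \<zeta>: "cmod \<zeta> = 1" and eps: "\<epsilon> \<ge> 0" "\<And>z. z \<in> U \<Longrightarrow> cmod (z - \<zeta>) \<le> \<epsilon>"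
  defines "u \<equiv> E U x"
  shows "cmod (ip (T u) y - \<zeta> * ip u y) \<le> \<epsilon> * nrm u * nrm y"
proof -
  have u: "u \<in> carrier H" unfolding u_def by (rule E_carrier[OF U x])
  interpret finite_measure "sm u" by (rule finite_measure_sm[OF u])
  define d where "d = T u \<oplus>\<^bsub>H\<^esub> ((- \<zeta>) \<odot>\<^bsub>H\<^esub> u)"
  have d: "d \<in> carrier H" using u by (simp add: d_def T_carrier)
  have zz: "\<zeta> * cnj \<zeta> = 1" using \<zeta> by (simp add: complex_norm_square[symmetric])
  have "ip d d = ip (T u) (T u) - cnj \<zeta> * ip (T u) u - \<zeta> * ip u (T u) + (\<zeta> * cnj \<zeta>) * ip u u"
    using u T_carrier[OF u]
    by (simp add: d_def ip_add_left ip_add_right ip_smult_left ip_smult_right algebra_simps)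
  also have "\<dots> = 2 * ip u u - (cnj \<zeta> * ip (T u) u + cnj (cnj \<zeta> * ip (T u) u))"
    using ip_cnj[OF T_carrier[OF u] u] by (simp add: zz T_isometry[OF u u])
  also have "Re \<dots> = 2 * (nrm u)\<^sup>2 - 2 * Re (cnj \<zeta> * ip (T u) u)"
    using nrm_power2[OF u] by simp
  finally have dd: "(nrm d)\<^sup>2 = 2 * (nrm u)\<^sup>2 - 2 * Re (cnj \<zeta> * ip (T u) u)"
    using nrm_power2[OF d] by simp
  have i: "integrable (sm u) (\<lambda>z. z)" "integrable (sm u) (\<lambda>z. (cmod (z - \<zeta>))\<^sup>2)"
    by (intro integrable_circle finite_measure_axioms sets_scalar_spectral_measure continuous_intros)+
  have "(\<integral>z. (cmod (z - \<zeta>))\<^sup>2 \<partial>sm u) = (\<integral>z. 2 - 2 * Re (cnj \<zeta> * z) \<partial>sm u)"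
  proof (intro Bochner_Integration.integral_cong refl)
    fix z assume "z \<in> space (sm u)"
    hence "(Re z)\<^sup>2 + (Im z)\<^sup>2 = 1" using cmod_power2[of z] by (simp add: space_sm)
    moreover have "(Re \<zeta>)\<^sup>2 + (Im \<zeta>)\<^sup>2 = 1" using cmod_power2[of \<zeta>] \<zeta> by simp
    ultimately show "(cmod (z - \<zeta>))\<^sup>2 = 2 - 2 * Re (cnj \<zeta> * z)"
      by (simp add: cmod_power2 power2_diff algebra_simps)
  qed
  also have "\<dots> = 2 * (nrm u)\<^sup>2 - 2 * Re (\<integral>z. cnj \<zeta> * z \<partial>sm u)"
    using i measure_sm_space[OF u] by (simp add: space_sm flip: integral_Re)
  also have "\<dots> = (nrm d)\<^sup>2"
    unfolding dd first_moment[OF u] by simp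
  finally have "(nrm d)\<^sup>2 = (\<integral>z. (cmod (z - \<zeta>))\<^sup>2 \<partial>sm u)" by simp
  also have "\<dots> \<le> (\<integral>z. \<epsilon>\<^sup>2 \<partial>sm u)"
  proof (rule integral_mono_AE)
    show "AE z in sm u. (cmod (z - \<zeta>))\<^sup>2 \<le> \<epsilon>\<^sup>2"
      using AE_sm_range[OF U x] unfolding u_def[symmetric]
      by eventually_elim (auto intro!: power_mono eps)
  qed (use i in auto)
  also have "\<dots> = (\<epsilon> * nrm u)\<^sup>2"
    using measure_sm_space[OF u] by (simp add: space_sm power_mult_distrib)
  finally have nd: "nrm d \<le> \<epsilon> * nrm u"
    by (rule power2_le_imp_le) (use eps(1) nrm_nonneg[OF u] in simp)
  have "ip (T u) y - \<zeta> * ip u y = ip d y"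
    using u y T_carrier[OF u] by (simp add: d_def ip_add_left ip_smult_left)
  also have "cmod \<dots> \<le> nrm d * nrm y" by (rule Cauchy_Schwarz[OF d y])
  also have "\<dots> \<le> \<epsilon> * nrm u * nrm y" by (intro mult_right_mono nd nrm_nonneg y)
  finally show ?thesis .
qed

text \<open>Writing y = T y' strips one power of \<open>T\<close> from both arguments. Each strip
  costs one application of \<open>approx_eigenvector\<close>, and since |y'| = |y| and |\<zeta>| = 1
  the errors simply add.\<close>

lemma approx_eigenvector_power:
  assumes U: "U \<in> sets circle" and x: "x \<in> carrier H" and y: "y \<in> carrier H"
    and \<zeta>: "cmod \<zeta> = 1" and eps: "\<epsilon> \<ge> 0" "\<And>z. z \<in> U \<Longrightarrow> cmod (z - \<zeta>) \<le> \<epsilon>"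
  defines "u \<equiv> E U x"
  shows "cmod (ip ((T ^^ l) u) y - \<zeta> ^ l * ip u y) \<le> real l * (\<epsilon> * nrm u * nrm y)"
  using y
proof (induction l arbitrary: y)
  case (Suc l)
  have u: "u \<in> carrier H" unfolding u_def by (rule E_carrier[OF U x])
  obtain y' where y': "y' \<in> carrier H" "y = T y'" using T_surj[OF Suc.prems] .
  have e: "ip ((T ^^ Suc l) u) y - \<zeta> ^ Suc l * ip u y =
      (ip ((T ^^ l) u) y' - \<zeta> ^ l * ip u y') + \<zeta> ^ l * (ip (T u) y - \<zeta> * ip u y)"
    using u y' by (simp add: T_isometry T_pow_carrier algebra_simps)
  have "cmod (ip ((T ^^ Suc l) u) y - \<zeta> ^ Suc l * ip u y) \<le>
      cmod (ip ((T ^^ l) u) y' - \<zeta> ^ l * ip u y') + cmod (ip (T u) y - \<zeta> * ip u y)"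
    unfolding e by (rule order_trans[OF norm_triangle_ineq]) (simp add: norm_mult norm_power \<zeta>)
  also have "\<dots> \<le> real l * (\<epsilon> * nrm u * nrm y') + \<epsilon> * nrm u * nrm y"
    using approx_eigenvector[OF U x Suc.prems \<zeta> eps]
    by (intro add_mono Suc.IH y') (simp add: u_def)
  also have "\<dots> = real (Suc l) * (\<epsilon> * nrm u * nrm y)"
    using y' by (simp add: nrm_T algebra_simps)
  finally show ?case .
qed simp

end

section \<open>Higher moments by Riemann sums over arcs\<close>

lemma cmod_cis_diff_le: "cmod (cis s - cis t) \<le> \<bar>s - t\<bar>"
proof -
  have "cis s - cis t = - (cis t * (1 - cis (s - t)))"
    by (simp add: cis_mult algebra_simps)
  hence "cmod (cis s - cis t) = 2 * \<bar>sin ((s - t) / 2)\<bar>"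
    by (simp only: norm_minus_cancel norm_mult norm_cis cmod_one_minus_cis mult_1)
  thus ?thesis using abs_sin_x_le_abs_x[of "(s - t) / 2"] by simp
qed

lemma circle_partition:
  assumes "r > 0"
  obtains A :: "nat \<Rightarrow> complex set" and \<zeta> :: "nat \<Rightarrow> complex"
  where "range A \<subseteq> sets circle" "disjoint_family A" "(\<Union>i. A i) = space circle"
    "\<And>i. i \<ge> r \<Longrightarrow> A i = {}" "\<And>i. cmod (\<zeta> i) = 1"
    "\<And>i z. z \<in> A i \<Longrightarrow> cmod (z - \<zeta> i) \<le> 2 * pi / r"
proof -
  define \<theta> where "\<theta> = 2 * pi / real r"
  have \<theta>: "\<theta> > 0" using assms by (simp add: \<theta>_def)
  \<comment> \<open>Closed arcs are compact, hence Borel; the shared end points are removed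
    afterwards by \<open>disjointed\<close>. The sequence is continued by empty sets because
    additivity of \<open>E\<close> is stated for infinite families.\<close>
  define B where "B i = (if i < r then cis ` {real i * \<theta>..real (Suc i) * \<theta>} else {})" for i
  have B_sets: "range B \<subseteq> sets circle"
  proof safe
    fix i
    have "compact (B i)"
      by (auto simp: B_def intro!: compact_continuous_image continuous_intros)
    hence "B i \<in> sets borel" by (simp add: compact_imp_closed)
    moreover have "B i \<subseteq> sphere 0 1" by (auto simp: B_def)
    ultimately show "B i \<in> sets circle" unfolding sets_circle by (auto intro!: image_eqI[of _ _ "B i"])
  qed
  have "z \<in> (\<Union>i. B i)" if "cmod z = 1" for z
  proof -
    define t where "t = Arg2pi z"
    have t: "0 \<le> t" "t < 2 * pi" "z = cis t"
      using Arg2pi[of z] that by (auto simp: t_def cis_conv_exp is_Arg_def)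
    define i where "i = nat \<lfloor>t / \<theta>\<rfloor>"
    have i: "real i \<le> t / \<theta>" "t / \<theta> < real (Suc i)"
      using t \<theta> real_of_int_floor_add_one_gt[of "t / \<theta>"] by (auto simp: i_def add.commute)
    have "t / \<theta> < real r" using t assms by (simp add: \<theta>_def field_simps)
    hence "i < r" using i by linarith
    moreover have "t \<in> {real i * \<theta>..real (Suc i) * \<theta>}"
      using i \<theta> by (simp add: field_simps)
    ultimately show ?thesis using t(3) by (auto simp: B_def)
  qed
  moreover have "B i \<subseteq> sphere 0 1" for i by (auto simp: B_def)
  ultimately have B_UN: "(\<Union>i. B i) = space circle" by (fastforce simp: space_circle)
  show thesis
  proof (rule that[of "disjointed B" "\<lambda>i. cis (real i * \<theta>)"])
    show "range (disjointed B) \<subseteq> sets circle" by (rule sets.range_disjointed_sets[OF B_sets])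
    show "disjoint_family (disjointed B)" by (rule disjoint_family_disjointed)
    show "(\<Union>i. disjointed B i) = space circle" by (simp add: UN_disjointed_eq B_UN)
    show "disjointed B i = {}" if "i \<ge> r" for i
      using disjointed_subset[of B i] that by (auto simp: B_def)
    show "cmod (z - cis (real i * \<theta>)) \<le> 2 * pi / real r" if z: "z \<in> disjointed B i" for i z
    proof -
      have "z \<in> B i" by (rule subsetD[OF disjointed_subset z])
      then obtain t where t: "z = cis t" "real i * \<theta> \<le> t" "t \<le> real (Suc i) * \<theta>"
        by (auto simp: B_def split: if_splits)
      have "cmod (z - cis (real i * \<theta>)) \<le> \<bar>t - real i * \<theta>\<bar>" unfolding t by (rule cmod_cis_diff_le)
      also have "\<dots> \<le> \<theta>" using t by (simp add: algebra_simps)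
      finally show ?thesis by (simp add: \<theta>_def)
    qed
  qed simp
qed

context hilbert_spectral
begin

lemma ip_finite_partition:
  fixes A :: "nat \<Rightarrow> complex set"
  assumes A: "range A \<subseteq> sets circle" "disjoint_family A" "(\<Union>i. A i) = space circle"
      "\<And>i. i \<ge> r \<Longrightarrow> A i = {}" and x: "x \<in> carrier H" and y: "y \<in> carrier H"
  shows "(\<Sum>i<r. ip (E (A i) x) y) = ip x y"
proof -
  have "(\<lambda>i. ip (E (A i) x) y) sums ip x y"
    using E_sums[OF A(1,2) x y] E_space[OF x] by (simp add: A(3))
  moreover have "(\<lambda>i. ip (E (A i) x) y) sums (\<Sum>i<r. ip (E (A i) x) y)"
    by (rule sums_finite) (use A(4) x y E_empty ip_zero_left in auto)
  ultimately show ?thesis using sums_unique2 by metis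
qed

text \<open>For a partition into \<open>r\<close> arcs of length \<open>2\<pi>/r\<close>, each piece \<open>E(A\<^sub>i)x\<close> is an approximate
  eigenvector up to \<open>O(1/r)\<close>; the norms of the pieces add up to at most \<open>\<surd>r \<parallel>x\<parallel>\<close>, so the total error
  is \<open>O(1/\<surd>r)\<close>. Taking \<open>r = n\<^sup>2\<close> avoids the square root.\<close>

lemma moment_approx:
  assumes x: "x \<in> carrier H" and n: "n > 0"
  shows "cmod (ip ((T ^^ l) x) x - (\<integral>z. z ^ l \<partial>sm x)) \<le> 4 * pi * real l * (nrm x)\<^sup>2 / real n"
proof -
  define r where "r = n\<^sup>2"
  have r: "r > 0" using n by (simp add: r_def)
  obtain A :: "nat \<Rightarrow> complex set" and \<zeta> where A: "range A \<subseteq> sets circle" "disjoint_family A"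
      "(\<Union>i. A i) = space circle" "\<And>i. i \<ge> r \<Longrightarrow> A i = {}"
    and \<zeta>: "\<And>i. cmod (\<zeta> i) = 1" and near: "\<And>i z. z \<in> A i \<Longrightarrow> cmod (z - \<zeta> i) \<le> 2 * pi / real r"
    using circle_partition[OF r] by metis
  have Ai: "A i \<in> sets circle" for i using A(1) by auto
  define \<epsilon> where "\<epsilon> = 2 * pi / real r"
  have eps: "\<epsilon> \<ge> 0" by (simp add: \<epsilon>_def)
  define u where "u i = E (A i) x" for i
  have u: "u i \<in> carrier H" for i unfolding u_def by (rule E_carrier[OF Ai x])
  interpret finite_measure "sm x" by (rule finite_measure_sm[OF x])
  define m where "m i = measure (sm x) (A i)" for i
  have m: "m i = (nrm (u i))\<^sup>2" for i unfolding m_def u_def by (rule measure_sm[OF Ai x])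
  have ip_u: "ip (u i) x = of_real (m i)" for i
    unfolding m u_def by (rule ip_E_self[OF Ai x])
  have "complex_of_real (\<Sum>i<r. m i) = of_real ((nrm x)\<^sup>2)"
    using ip_finite_partition[OF A x x] ip_u[unfolded u_def] ip_self_real[OF x] nrm_power2[OF x] by simp
  hence sum_m: "(\<Sum>i<r. m i) = (nrm x)\<^sup>2" by (simp only: of_real_eq_iff)
  \<comment> \<open>The Riemann sum with which both the operator moment and the integral are
    compared.\<close>
  define q where "q = (\<Sum>i<r. \<zeta> i ^ l * of_real (m i))"
  have 1: "cmod (ip ((T ^^ l) x) x - q) \<le> real l * \<epsilon> * real n * (nrm x)\<^sup>2"
  proof -
    have sum_nrm: "(\<Sum>i<r. nrm (u i)) \<le> real n * nrm x"
    proof (rule power2_le_imp_le)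
      show "(\<Sum>i<r. nrm (u i))\<^sup>2 \<le> (real n * nrm x)\<^sup>2"
        using Cauchy_Schwarz_ineq_sum[of "\<lambda>i. nrm (u i)" "\<lambda>i. 1" "{..<r}"]
        unfolding m[symmetric] sum_m power_mult_distrib by (simp add: r_def mult.commute)
    qed (use nrm_nonneg[OF x] in simp)
    \<comment> \<open>The decomposition of \<open>x\<close> into its pieces is available only inside
      an inner product, so the powers of \<open>T\<close> are moved off \<open>x\<close>, the sum is
      expanded, and they are put back on each piece.\<close>
    obtain y where y: "y \<in> carrier H" "x = (T ^^ l) y" using T_pow_surj[OF x] .
    have "ip ((T ^^ l) x) x = ip x y" using T_pow_isometry[OF x y(1), of l] y(2) by simp
    also have "\<dots> = (\<Sum>i<r. ip (u i) y)" unfolding u_def by (rule ip_finite_partition[OF A x y(1), symmetric])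
    also have "\<dots> = (\<Sum>i<r. ip ((T ^^ l) (u i)) x)"
      by (subst y(2)) (simp add: T_pow_isometry u y(1))
    finally have "cmod (ip ((T ^^ l) x) x - q) = cmod (\<Sum>i<r. ip ((T ^^ l) (u i)) x - \<zeta> i ^ l * ip (u i) x)"
      by (simp add: q_def ip_u sum_subtractf)
    also have "\<dots> \<le> (\<Sum>i<r. real l * (\<epsilon> * nrm (u i) * nrm x))"
    proof (rule sum_norm_le)
      fix i
      show "cmod (ip ((T ^^ l) (u i)) x - \<zeta> i ^ l * ip (u i) x) \<le> real l * (\<epsilon> * nrm (u i) * nrm x)"
        unfolding u_def
        by (rule approx_eigenvector_power[OF Ai x x \<zeta> eps]) (use near in \<open>simp add: \<epsilon>_def\<close>)
    qed
    also have "\<dots> = real l * \<epsilon> * nrm x * (\<Sum>i<r. nrm (u i))"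
      by (simp add: sum_distrib_left ac_simps)
    also have "\<dots> \<le> real l * \<epsilon> * nrm x * (real n * nrm x)"
      using eps nrm_nonneg[OF x] by (intro mult_left_mono sum_nrm) auto
    finally show ?thesis by (simp add: power2_eq_square ac_simps)
  qed
  have 2: "cmod ((\<integral>z. z ^ l \<partial>sm x) - q) \<le> real l * \<epsilon> * (nrm x)\<^sup>2"
  proof -
    define h where "h z = (\<Sum>i<r. indicator (A i) z *\<^sub>R \<zeta> i ^ l)" for z
    have ind: "integrable (sm x) (\<lambda>z. indicator (A i) z *\<^sub>R \<zeta> i ^ l)" for i
      using Ai by (intro integrable_real_indicator integrable_scaleR_left) (auto simp: emeasure_finite less_top[symmetric])
    have h_int: "integrable (sm x) h"
      unfolding h_def by (intro Bochner_Integration.integrable_sum ind)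
    have z_int: "integrable (sm x) (\<lambda>z. z ^ l)"
      by (intro integrable_circle finite_measure_axioms sets_scalar_spectral_measure continuous_intros)
    have "(\<integral>z. h z \<partial>sm x) = (\<Sum>i<r. \<integral>z. indicator (A i) z *\<^sub>R \<zeta> i ^ l \<partial>sm x)"
      unfolding h_def by (rule Bochner_Integration.integral_sum) (rule ind)
    also have "\<dots> = q"
      unfolding q_def
    proof (intro sum.cong refl)
      fix i
      have "integrable (sm x) (indicator (A i) :: complex \<Rightarrow> real)"
        using Ai by (intro integrable_real_indicator) (auto simp: emeasure_finite less_top[symmetric])
      hence "(\<integral>z. indicator (A i) z *\<^sub>R \<zeta> i ^ l \<partial>sm x) = measure (sm x) (A i \<inter> space (sm x)) *\<^sub>R \<zeta> i ^ l"
        by (subst integral_scaleR_left) auto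
      also have "A i \<inter> space (sm x) = A i" using sets.sets_into_space[OF Ai[of i]] by (auto simp: space_sm space_circle)
      finally show "(\<integral>z. indicator (A i) z *\<^sub>R \<zeta> i ^ l \<partial>sm x) = \<zeta> i ^ l * of_real (m i)"
        by (simp add: m_def scaleR_conv_of_real mult.commute)
    qed
    finally have "(\<integral>z. h z \<partial>sm x) = q" .
    hence "(\<integral>z. z ^ l \<partial>sm x) - q = (\<integral>z. z ^ l - h z \<partial>sm x)"
      using h_int z_int by simp
    also have "cmod \<dots> \<le> (\<integral>z. cmod (z ^ l - h z) \<partial>sm x)" by (rule integral_norm_bound)
    also have "\<dots> \<le> (\<integral>z. real l * \<epsilon> \<partial>sm x)"
    proof (rule integral_mono)
      fix z assume z: "z \<in> space (sm x)"
      hence "z \<in> (\<Union>i. A i)" by (simp add: A(3) space_circle space_sm)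
      then obtain i where i: "z \<in> A i" by blast
      have ir: "i < r" using A(4)[of i] i by (cases "i < r") auto
      have ind_eq: "indicator (A j) z = (if j = i then 1 else 0 :: real)" for j
        using A(2) i by (auto simp: disjoint_family_on_def indicator_def)
      hence "h z = \<zeta> i ^ l" using ir unfolding h_def ind_eq by (simp add: if_distrib[of "\<lambda>c. c *\<^sub>R _"] cong: if_cong)
      hence "cmod (z ^ l - h z) \<le> real l * cmod (z - \<zeta> i)"
        using norm_power_diff[of z "\<zeta> i" l] z \<zeta>[of i] by (simp add: space_sm)
      also have "\<dots> \<le> real l * \<epsilon>" using near[OF i] by (intro mult_left_mono) (auto simp: \<epsilon>_def)
      finally show "cmod (z ^ l - h z) \<le> real l * \<epsilon>" .
    qed (use h_int z_int in auto)
    also have "\<dots> = real l * \<epsilon> * (nrm x)\<^sup>2"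
      using measure_sm_space[OF x] by (simp add: space_sm)
    finally show ?thesis .
  qed
  have "cmod (ip ((T ^^ l) x) x - (\<integral>z. z ^ l \<partial>sm x)) \<le> real l * \<epsilon> * real n * (nrm x)\<^sup>2 + real l * \<epsilon> * (nrm x)\<^sup>2"
    using norm_triangle_ineq4[of "ip ((T ^^ l) x) x - q" "(\<integral>z. z ^ l \<partial>sm x) - q"] 1 2 by simp
  also have "\<dots> = real l * \<epsilon> * (nrm x)\<^sup>2 * (real n + 1)" by (simp add: algebra_simps)
  also have "\<dots> \<le> real l * \<epsilon> * (nrm x)\<^sup>2 * (2 * real n)"
    using n eps by (intro mult_left_mono) auto
  also have "\<dots> = 4 * pi * real l * (nrm x)\<^sup>2 / real n"
    using n by (simp add: \<epsilon>_def r_def power2_eq_square)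
  finally show ?thesis .
qed

text \<open>The bound of \<open>moment_approx\<close> holds for every \<open>n\<close> while its
  left side does not involve \<open>n\<close>.\<close>

lemma spectral_moment:
  assumes x: "x \<in> carrier H"
  shows "ip ((T ^^ l) x) x = (\<integral>z. z ^ l \<partial>sm x)"
proof -
  define K where "K = 4 * pi * real l * (nrm x)\<^sup>2"
  have "(\<lambda>n. K / real (Suc n)) \<longlonglongrightarrow> 0" by (rule LIMSEQ_Suc[OF lim_const_over_n])
  moreover have "cmod (ip ((T ^^ l) x) x - (\<integral>z. z ^ l \<partial>sm x)) \<le> K / real (Suc n)" for n
    unfolding K_def by (rule moment_approx[OF x]) simp
  ultimately have "cmod (ip ((T ^^ l) x) x - (\<integral>z. z ^ l \<partial>sm x)) \<le> 0"
    by (intro LIMSEQ_le_const) auto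
  thus ?thesis by simp
qed

end

section \<open>The spectral data of mpEDMD\<close>

lemma mat_adjoint_dim [simp]:
  "dim_row (mat_adjoint A) = dim_col A" "dim_col (mat_adjoint A) = dim_row A"
  by (auto simp: mat_adjoint_def)

lemma mat_adjoint_carrier [simp]: "A \<in> carrier_mat n m \<Longrightarrow> mat_adjoint A \<in> carrier_mat m n"
  by (auto intro: carrier_matI)

lemma mat_adjoint_index:
  fixes A :: "complex mat"
  assumes "i < dim_col A" "j < dim_row A"
  shows "mat_adjoint A $$ (i, j) = cnj (A $$ (j, i))"
  using assms by (simp add: mat_adjoint_def mat_of_rows_index)

lemma mat_adjoint_mult:
  fixes A B :: "complex mat"
  assumes "A \<in> carrier_mat n m" "B \<in> carrier_mat m k"
  shows "mat_adjoint (A * B) = mat_adjoint B * mat_adjoint A"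
  using assms
  by (intro eq_matI) (auto simp: mat_adjoint_index scalar_prod_def mult.commute intro!: sum.cong)

lemma mat_adjoint_adjoint: "mat_adjoint (mat_adjoint A) = (A :: complex mat)"
  by (intro eq_matI) (auto simp: mat_adjoint_index)

lemma cscalar_prod_adjoint:
  fixes A :: "complex mat"
  assumes "A \<in> carrier_mat n m" "v \<in> carrier_vec m" "w \<in> carrier_vec n"
  shows "(A *\<^sub>v v) \<bullet>c w = v \<bullet>c (mat_adjoint A *\<^sub>v w)"
proof -
  have "(A *\<^sub>v v) \<bullet>c w = (\<Sum>i\<in>{0..<n}. \<Sum>j\<in>{0..<m}. A $$ (i, j) * v $ j * cnj (w $ i))"
    using assms by (simp add: scalar_prod_def sum_distrib_right)
  also have "\<dots> = (\<Sum>j\<in>{0..<m}. \<Sum>i\<in>{0..<n}. A $$ (i, j) * v $ j * cnj (w $ i))"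
    by (rule sum.swap)
  also have "\<dots> = v \<bullet>c (mat_adjoint A *\<^sub>v w)"
    using assms
    by (auto simp: scalar_prod_def sum_distrib_left mat_adjoint_index ac_simps intro!: sum.cong)
  finally show ?thesis .
qed

lemma unitary_mat_adjoint: "unitary_mat n U \<Longrightarrow> unitary_mat n (mat_adjoint U)"
  by (simp add: unitary_mat_def mat_adjoint_adjoint)

lemma unitary_mat_mult:
  assumes "unitary_mat n U" "unitary_mat n V"
  shows "unitary_mat n (U * V)"
proof -
  have U: "U \<in> carrier_mat n n" "mat_adjoint U * U = 1\<^sub>m n" "U * mat_adjoint U = 1\<^sub>m n"
    and V: "V \<in> carrier_mat n n" "mat_adjoint V * V = 1\<^sub>m n" "V * mat_adjoint V = 1\<^sub>m n"
    using assms by (auto simp: unitary_mat_def)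
  have U': "mat_adjoint U \<in> carrier_mat n n" and V': "mat_adjoint V \<in> carrier_mat n n"
    using U V by auto
  have "mat_adjoint (U * V) * (U * V) = mat_adjoint V * (mat_adjoint U * U) * V"
    unfolding mat_adjoint_mult[OF U(1) V(1)] using U(1) V(1) U' V'
    by (simp add: assoc_mult_mat[of _ n n _ n _ n] mult_carrier_mat[of _ n n _ n])
  moreover have "(U * V) * mat_adjoint (U * V) = U * (V * mat_adjoint V) * mat_adjoint U"
    unfolding mat_adjoint_mult[OF U(1) V(1)] using U(1) V(1) U' V'
    by (simp add: assoc_mult_mat[of _ n n _ n _ n] mult_carrier_mat[of _ n n _ n])
  ultimately show ?thesis using U V U' V' by (simp add: unitary_mat_def)
qed

lemma unitary_mat_diag_entry:
  assumes "unitary_mat n (mat_diag n f)" "j < n"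
  shows "cmod (f j) = 1"
proof -
  have "(mat_adjoint (mat_diag n f) * mat_diag n f) $$ (j, j) = 1"
    using assms by (simp add: unitary_mat_def)
  hence "(mat_adjoint (mat_diag n f)) $$ (j, j) * f j = 1"
    using assms(2) by (subst (asm) mat_diag_mult_right[of _ n]) auto
  hence "cnj (f j) * f j = 1"
    using assms(2) by (simp add: mat_adjoint_index mat_diag_def)
  hence "complex_of_real ((cmod (f j))\<^sup>2) = of_real 1"
    by (simp only: complex_norm_square) (simp add: mult.commute)
  thus ?thesis by (simp only: of_real_eq_iff) (simp add: power2_eq_1_iff, use norm_ge_zero[of "f j"] in linarith)
qed

text \<open>S = G^(1/2) carries the G-inner product to the Euclidean one and intertwines
  \<open>K\<close> with the unitary matrix Q: S K = Q S. Diagonalising Q by \<open>W\<close>, the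
  vector S c has coordinates b = W* S c, so c* G K^l c is the sum of lam_j^l |b_j|^2. Because S R =
  1, the number v_j* G c is the same b_j.\<close>

lemma mpEDMD_spectral_data:
  assumes mp: "mpEDMD N G A K V lam" and c: "c \<in> carrier_vec N"
  shows "\<And>j. j < N \<Longrightarrow> cmod (lam j) = 1"
    and "((G * K ^\<^sub>m l) *\<^sub>v c) \<bullet>c c = (\<Sum>j<N. lam j ^ l * of_real ((cmod ((G *\<^sub>v c) \<bullet>c col V j))\<^sup>2))"
proof -
  obtain S R U\<^sub>1 U\<^sub>2 W where S: "positive_sqrt_mat N G S"
    and R: "R \<in> carrier_mat N N" "inverts_mat R S" "inverts_mat S R"
    and U: "unitary_mat N U\<^sub>1" "unitary_mat N U\<^sub>2"
    and K: "K = R * U\<^sub>2 * mat_adjoint U\<^sub>1 * S"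
    and W: "unitary_mat N W"
    and Q: "U\<^sub>2 * mat_adjoint U\<^sub>1 = W * mat_diag N lam * mat_adjoint W"
    and V: "V = R * W"
    using mp unfolding mpEDMD_def by blast
  have Sc: "S \<in> carrier_mat N N" "mat_adjoint S = S" "S * S = G"
    using S by (auto simp: positive_sqrt_mat_def)
  have Wc: "W \<in> carrier_mat N N" "mat_adjoint W * W = 1\<^sub>m N" "W * mat_adjoint W = 1\<^sub>m N"
    using W by (auto simp: unitary_mat_def)
  have W'c: "mat_adjoint W \<in> carrier_mat N N" using Wc by simp
  have Uc: "U\<^sub>1 \<in> carrier_mat N N" "U\<^sub>2 \<in> carrier_mat N N" using U by (auto simp: unitary_mat_def)
  have SR: "S * R = 1\<^sub>m N" using R(3) Sc by (simp add: inverts_mat_def)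
  define Q where "Q = U\<^sub>2 * mat_adjoint U\<^sub>1"
  define \<Lambda> where "\<Lambda> = mat_diag N lam"
  have Qc: "Q \<in> carrier_mat N N" and \<Lambda>c: "\<Lambda> \<in> carrier_mat N N" using Uc by (auto simp: Q_def \<Lambda>_def)
  have Q_eq: "Q = W * \<Lambda> * mat_adjoint W" using Q by (simp add: Q_def \<Lambda>_def)
  note assoc = assoc_mult_mat[of _ N N _ N _ N]
  have WQ: "mat_adjoint W * Q = \<Lambda> * mat_adjoint W"
  proof -
    have "mat_adjoint W * Q = (mat_adjoint W * W) * (\<Lambda> * mat_adjoint W)"
      unfolding Q_eq using Wc(1) W'c \<Lambda>c by (simp add: assoc)
    thus ?thesis using Wc \<Lambda>c W'c by simp
  qed
  have "mat_adjoint W * Q * W = \<Lambda>"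
    unfolding WQ using Wc W'c \<Lambda>c by (simp add: assoc)
  hence "unitary_mat N \<Lambda>"
    using unitary_mat_mult[OF unitary_mat_mult[OF unitary_mat_adjoint[OF W] unitary_mat_mult[OF U(2) unitary_mat_adjoint[OF U(1)]]] W]
    by (simp add: Q_def)
  thus "cmod (lam j) = 1" if "j < N" for j
    using unitary_mat_diag_entry[OF _ that] by (simp add: \<Lambda>_def)
  define s where "s = S *\<^sub>v c"
  have s: "s \<in> carrier_vec N" using Sc c by (auto simp: s_def)
  define b where "b = mat_adjoint W *\<^sub>v s"
  have b: "b \<in> carrier_vec N" using W'c s by (auto simp: b_def)
  have Kc: "K \<in> carrier_mat N N" using K R(1) Uc Sc by auto
  have SK: "S * K = Q * S"
  proof -
    have "S * K = (S * R) * (Q * S)"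
      unfolding K Q_def using R(1) Uc Sc(1) by (simp add: assoc mult_carrier_mat[of _ N N _ N])
    thus ?thesis using SR Qc Sc by simp
  qed
  have Kl: "K ^\<^sub>m l \<in> carrier_mat N N" for l using Kc by simp
  define y where "y l = S *\<^sub>v (K ^\<^sub>m l *\<^sub>v c)" for l
  have y: "y l \<in> carrier_vec N" for l unfolding y_def by (intro mult_mat_vec_carrier[of _ N N] Sc(1) Kl c)
  have y_Suc: "y (Suc l) = Q *\<^sub>v y l" for l
  proof -
    \<comment> \<open>Matrix powers are defined with the new factor on the right, while S K = Q S
      consumes one on the left.\<close>
    have comm: "K ^\<^sub>m Suc l = K * K ^\<^sub>m l"
    proof (induction l)
      case (Suc l)
      have "K ^\<^sub>m Suc (Suc l) = (K * K ^\<^sub>m l) * K" using Suc by simp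
      also have "\<dots> = K * K ^\<^sub>m Suc l" using Kc Kl[of l] by (simp add: assoc)
      finally show ?case .
    qed (use Kc in simp)
    have "y (Suc l) = (S * (K * K ^\<^sub>m l)) *\<^sub>v c"
      unfolding y_def comm using Sc(1) Kc Kl c by (simp add: assoc_mult_mat_vec[of _ N N _ N] mult_carrier_mat[of _ N N _ N])
    also have "S * (K * K ^\<^sub>m l) = (Q * S) * K ^\<^sub>m l"
      unfolding SK[symmetric] using Sc(1) Kc Kl by (simp add: assoc)
    also have "\<dots> *\<^sub>v c = Q *\<^sub>v y l"
      unfolding y_def using Sc(1) Qc Kl c by (simp add: assoc assoc_mult_mat_vec[of _ N N _ N] mult_carrier_mat[of _ N N _ N])
    finally show ?thesis .
  qed
  have Wy: "mat_adjoint W *\<^sub>v y l = Matrix.vec N (\<lambda>j. lam j ^ l * b $ j)" for l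
  proof (induction l)
    case 0
    have "y 0 = s" using Kc c by (simp add: y_def s_def)
    thus ?case using b Wc(1) W'c by (intro eq_vecI) (auto simp: b_def)
  next
    case (Suc l)
    have "mat_adjoint W *\<^sub>v y (Suc l) = (mat_adjoint W * Q) *\<^sub>v y l"
      unfolding y_Suc using W'c Qc y by simp
    also have "\<dots> = \<Lambda> *\<^sub>v (mat_adjoint W *\<^sub>v y l)"
      unfolding WQ using W'c \<Lambda>c y by simp
    also have "\<dots> = Matrix.vec N (\<lambda>j. lam j ^ Suc l * b $ j)"
      unfolding Suc by (intro eq_vecI)
        (auto simp: \<Lambda>_def mat_diag_def scalar_prod_def if_distrib[of "\<lambda>x. x * _"] cong: if_cong)
    finally show ?case .
  qed
  have WW: "W *\<^sub>v b = s"
    unfolding b_def using Wc W'c s by (subst assoc_mult_mat_vec[symmetric, of _ N N _ N]) auto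
  have coeff: "(G *\<^sub>v c) \<bullet>c col V j = b $ j" if j: "j < N" for j
  proof -
    have colW: "col W j \<in> carrier_vec N" using Wc(1) by auto
    have colV: "col V j = R *\<^sub>v col W j" unfolding V using R(1) Wc(1) j by (intro col_mult2)
    have Rv: "R *\<^sub>v col W j \<in> carrier_vec N" using R(1) colW by auto
    have "(G *\<^sub>v c) \<bullet>c col V j = (S *\<^sub>v s) \<bullet>c (R *\<^sub>v col W j)"
      unfolding colV s_def Sc(3)[symmetric] using Sc(1) c by simp
    also have "\<dots> = s \<bullet>c (S *\<^sub>v (R *\<^sub>v col W j))"
      using cscalar_prod_adjoint[OF Sc(1) s Rv] by (simp add: Sc(2))
    also have "S *\<^sub>v (R *\<^sub>v col W j) = col W j"
      using Sc(1) R(1) colW SR by (simp flip: assoc_mult_mat_vec[of _ N N _ N])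
    also have "s \<bullet>c col W j = b $ j"
      unfolding b_def using W'c Wc s j
      by (auto simp: scalar_prod_def mat_adjoint_index mult.commute intro!: sum.cong)
    finally show ?thesis .
  qed
  have "((G * K ^\<^sub>m l) *\<^sub>v c) \<bullet>c c = (S *\<^sub>v y l) \<bullet>c c"
    unfolding y_def Sc(3)[symmetric] using Sc(1) Kl c by (simp add: assoc assoc_mult_mat_vec[of _ N N _ N] mult_carrier_mat[of _ N N _ N])
  also have "\<dots> = y l \<bullet>c s"
    unfolding s_def using cscalar_prod_adjoint[OF Sc(1) y c] by (simp add: Sc(2))
  also have "\<dots> = (mat_adjoint W *\<^sub>v y l) \<bullet>c b"
    using cscalar_prod_adjoint[OF W'c y b] by (simp add: mat_adjoint_adjoint WW)
  also have "\<dots> = (\<Sum>j<N. lam j ^ l * of_real ((cmod (b $ j))\<^sup>2))"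
    unfolding Wy complex_norm_square using b
    by (simp add: scalar_prod_def atLeast0LessThan mult.assoc)
  also have "\<dots> = (\<Sum>j<N. lam j ^ l * of_real ((cmod ((G *\<^sub>v c) \<bullet>c col V j))\<^sup>2))"
    by (intro sum.cong refl) (simp add: coeff)
  finally show "((G * K ^\<^sub>m l) *\<^sub>v c) \<bullet>c c = (\<Sum>j<N. lam j ^ l * of_real ((cmod ((G *\<^sub>v c) \<bullet>c col V j))\<^sup>2))" .
qed

section \<open>The mpEDMD measure as an image measure\<close>

text \<open>Turns integrals into finite sums over indices, with repeated eigenvalues accounted for
  automatically. Unit modulus of the eigenvalues is what makes \<open>lam\<close> a map into the
  circle.\<close>

lemma mpEDMD_measure_eq_distr:
  assumes lam: "\<And>j. j < N \<Longrightarrow> cmod (lam j) = 1"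
  shows "mpEDMD_measure N G V lam c =
    distr (point_measure {..<N} (\<lambda>j. ennreal ((cmod ((G *\<^sub>v c) \<bullet>c col V j))\<^sup>2))) circle lam"
    (is "_ = ?D")
proof -
  have "mpEDMD_measure N G V lam c = measure_of (space circle) (sets circle) (emeasure ?D)"
    unfolding mpEDMD_measure_def
  proof (rule measure_of_eq)
    fix U assume "U \<in> sigma_sets (space circle) (sets circle)"
    hence U: "U \<in> sets circle" by (simp add: sets.sigma_sets_eq)
    have vimage: "lam -` U \<inter> {..<N} = {j. j < N \<and> lam j \<in> U}" by auto
    have sub: "{j. j < N \<and> lam j \<in> U} \<subseteq> {..<N}" by auto
    thus "ennreal (\<Sum>j | j < N \<and> lam j \<in> U. (cmod ((G *\<^sub>v c) \<bullet>c col V j))\<^sup>2) = emeasure ?D U"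
      using U lam
      by (subst emeasure_distr)
        (auto simp: space_circle space_point_measure vimage emeasure_point_measure_finite[OF _ sub] simp flip: sum_ennreal)
  qed (rule sets.space_closed)
  also have "\<dots> = ?D"
    using measure_of_of_measure[of ?D] by simp
  finally show ?thesis .
qed

lemma mpEDMD_measure_moment:
  assumes mp: "mpEDMD N G A K V lam" and c: "c \<in> carrier_vec N"
  shows "(\<integral>z. z ^ l \<partial>mpEDMD_measure N G V lam c) = ((G * K ^\<^sub>m l) *\<^sub>v c) \<bullet>c c"
proof -
  note lam = mpEDMD_spectral_data(1)[OF mp c]
  have eq: "mpEDMD_measure N G V lam c =
      distr (point_measure {..<N} (\<lambda>j. ennreal ((cmod ((G *\<^sub>v c) \<bullet>c col V j))\<^sup>2))) circle lam"
    by (rule mpEDMD_measure_eq_distr) (rule lam)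
  have "(\<lambda>z. z ^ l) \<in> borel_measurable circle"
    by (intro borel_measurable_circle refl continuous_intros)
  thus ?thesis
    unfolding eq mpEDMD_spectral_data(2)[OF mp c]
    using lam by (subst integral_distr)
      (auto simp: space_circle lebesgue_integral_point_measure_finite scaleR_conv_of_real mult.commute)
qed

text \<open>The total mass is the moment of order 0, that is c* G c.\<close>

lemma prob_space_mpEDMD_measure:
  assumes mp: "mpEDMD N G A K V lam" and G: "G \<in> carrier_mat N N"
    and c: "c \<in> carrier_vec N" and unit: "(G *\<^sub>v c) \<bullet>c c = 1"
  shows "prob_space (mpEDMD_measure N G V lam c)"
proof
  note lam = mpEDMD_spectral_data(1)[OF mp c]
  have eq: "mpEDMD_measure N G V lam c =
      distr (point_measure {..<N} (\<lambda>j. ennreal ((cmod ((G *\<^sub>v c) \<bullet>c col V j))\<^sup>2))) circle lam"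
    by (rule mpEDMD_measure_eq_distr) (rule lam)
  define p where "p j = (cmod ((G *\<^sub>v c) \<bullet>c col V j))\<^sup>2" for j
  have "K \<in> carrier_mat N N"
    using mp by (auto simp: mpEDMD_def positive_sqrt_mat_def unitary_mat_def)
  hence "complex_of_real (\<Sum>j<N. p j) = 1"
    using mpEDMD_spectral_data(2)[OF mp c, of 0] unit G by (simp add: p_def)
  hence "(\<Sum>j<N. p j) = 1" by (simp only: of_real_eq_1_iff)
  hence "(\<Sum>j<N. ennreal (p j)) = 1" by (subst sum_ennreal) (auto simp: p_def)
  moreover have "sphere 0 1 \<in> sets circle" using sets.top[of circle] by (simp add: space_circle)
  moreover have "lam -` space circle \<inter> {..<N} = {..<N}" using lam by (auto simp: space_circle)
  ultimately show "emeasure (mpEDMD_measure N G V lam c) (space (mpEDMD_measure N G V lam c)) = 1"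
    unfolding eq p_def[symmetric] using lam
    by (subst emeasure_distr)
      (auto simp: space_circle space_point_measure emeasure_point_measure_finite)
qed

lemma sets_mpEDMD_measure [simp]: "sets (mpEDMD_measure N G V lam c) = sets circle"
  unfolding mpEDMD_measure_def
  by (subst sets_measure_of) (use sets.sigma_sets_eq[of circle] sets.space_closed[of circle] in auto)

section \<open>The Koopman operator and the main estimate\<close>

lemma koopman_L2_carrier:
  assumes mp: "measure_preserving_system d \<Omega> \<omega> F" and f: "f \<in> L2_carrier \<omega>"
  shows "koopman F f \<in> L2_carrier \<omega>"
proof -
  have F: "F \<in> measurable \<omega> \<omega>" and D: "distr \<omega> \<omega> F = \<omega>"
    using mp by (auto simp: measure_preserving_system_def)
  have f': "f \<in> borel_measurable \<omega>" "integrable \<omega> (\<lambda>x. (cmod (f x))\<^sup>2)"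
    using f by (auto simp: L2_carrier_def)
  have "integrable (distr \<omega> \<omega> F) (\<lambda>x. (cmod (f x))\<^sup>2)" unfolding D by (rule f'(2))
  hence "integrable \<omega> (\<lambda>x. (cmod (f (F x)))\<^sup>2)"
    by (rule integrable_distr[OF F])
  moreover have "f \<circ> F \<in> borel_measurable \<omega>" using F f'(1) by (rule measurable_comp)
  ultimately show ?thesis by (simp add: L2_carrier_def koopman_def)
qed

lemma koopman_pow_L2_carrier:
  assumes "measure_preserving_system d \<Omega> \<omega> F" "f \<in> L2_carrier \<omega>"
  shows "(koopman F ^^ l) f \<in> L2_carrier \<omega>"
  by (induction l) (auto simp: assms koopman_L2_carrier[OF assms(1)])

lemma L2_inner_self:
  assumes "L2_norm \<omega> f = 1"
  shows "L2_inner \<omega> f f = 1"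
proof -
  have "(\<integral>x. (cmod (f x))\<^sup>2 \<partial>\<omega>) = 1" using assms by (simp add: L2_norm_def)
  moreover have "L2_inner \<omega> f f = of_real (\<integral>x. (cmod (f x))\<^sup>2 \<partial>\<omega>)"
    unfolding L2_inner_def integral_complex_of_real[symmetric] by (simp only: complex_norm_square)
  ultimately show ?thesis by simp
qed

text \<open>Compression does not change the scalar measure: what the projection discards is
  orthogonal to \<open>J g\<close>. So the measure of \<open>g\<close> is that of \<open>J g\<close>
  under the unitary extension, whose nonnegative powers act on \<open>J g\<close> as powers of the
  Koopman operator.\<close>

lemma koopman_spectral_measure_prob_moments:
  assumes mp: "measure_preserving_system d \<Omega> \<omega> F" and E: "koopman_spectral_measure \<omega> F E"
    and g: "g \<in> L2_carrier \<omega>" "L2_norm \<omega> g = 1"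
  shows "prob_space (scalar_spectral_measure (L2_inner \<omega>) E g)"
    and "(\<integral>z. z ^ l \<partial>scalar_spectral_measure (L2_inner \<omega>) E g) = L2_inner \<omega> ((koopman F ^^ l) g) g"
proof -
  obtain H :: "(real Matrix.vec \<Rightarrow> complex) inner_space" and J T E' P
    where ext: "koopman_unitary_extension \<omega> F H J T" and spec: "spectral_measure_of H T E'"
      and proj: "orthogonal_projection_onto_L2 \<omega> H J P" and E_eq: "E = (\<lambda>U f. P (E' U (J f)))"
    using E unfolding koopman_spectral_measure_def by blast
  interpret hilbert_spectral H E' T
    by unfold_locales
      (use ext spec in \<open>auto simp: koopman_unitary_extension_def spectral_measure_of_def\<close>)
  have J: "J f \<in> carrier H" if "f \<in> L2_carrier \<omega>" for f
    using ext that by (auto simp: koopman_unitary_extension_def)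
  have J_ip: "ip (J f) (J f') = L2_inner \<omega> f f'" if "f \<in> L2_carrier \<omega>" "f' \<in> L2_carrier \<omega>" for f f'
    using ext that by (simp add: koopman_unitary_extension_def)
  have TJ: "T (J f) = J (koopman F f)" if "f \<in> L2_carrier \<omega>" for f
    using ext that by (simp add: koopman_unitary_extension_def)
  have sm_eq: "scalar_spectral_measure (L2_inner \<omega>) E g = sm (J g)"
  proof (rule scalar_spectral_measure_cong)
    fix U assume "U \<in> sets circle"
    hence x: "E' U (J g) \<in> carrier H" using E_carrier J g by blast
    hence P: "P (E' U (J g)) \<in> L2_carrier \<omega>"
      and orth: "ip (E' U (J g) \<ominus>\<^bsub>H\<^esub> J (P (E' U (J g)))) (J g) = 0"
      using proj g by (auto simp: orthogonal_projection_onto_L2_def)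
    show "L2_inner \<omega> (E U g) g = ip (E' U (J g)) (J g)"
      using orth ip_minus_left[OF x J[OF P] J[OF g(1)]] J_ip[OF P g(1)] by (simp add: E_eq)
  qed
  have "ip (J g) (J g) = 1" using J_ip g L2_inner_self by simp
  hence "(nrm (J g))\<^sup>2 = 1" using nrm_power2[OF J[OF g(1)]] by simp
  thus "prob_space (scalar_spectral_measure (L2_inner \<omega>) E g)"
    unfolding sm_eq using emeasure_sm[OF sets.top J[OF g(1)]] E_space[OF J[OF g(1)]]
    by (intro prob_spaceI) (simp add: space_sm space_circle)
  have "(T ^^ l) (J g) = J ((koopman F ^^ l) g)"
    by (induction l) (auto simp: TJ koopman_pow_L2_carrier[OF mp g(1)])
  thus "(\<integral>z. z ^ l \<partial>scalar_spectral_measure (L2_inner \<omega>) E g) = L2_inner \<omega> ((koopman F ^^ l) g) g"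
    unfolding sm_eq spectral_moment[OF J[OF g(1)], symmetric]
    by (simp add: J_ip koopman_pow_L2_carrier[OF mp g(1)] g)
qed

text \<open>Weakens the 1/(L+1) of the approximation to log(L)/L. The factor 2 is room for ln 2 >=
  1/2; at L = 1 the right side would be zero.\<close>

lemma inverse_Suc_le_ln_div:
  assumes "L \<ge> (2::nat)"
  shows "1 / real (Suc L) \<le> 2 * (ln (real L) / real L)"
proof -
  have "1 / 2 \<le> ln (2::real)" using ln_le_minus_one[of "1/2::real"] by (simp add: ln_div)
  also have "\<dots> \<le> ln (real L)" using assms by simp
  finally have "1 \<le> 2 * ln (real L)" by simp
  hence "1 / real L \<le> 2 * (ln (real L) / real L)" using assms by (simp add: divide_right_mono field_simps)
  moreover have "1 / real (Suc L) \<le> 1 / real L" using assms by (intro divide_left_mono) auto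
  ultimately show ?thesis by simp
qed

theorem theorem5p5:
  shows "\<exists>C>0. \<forall>(d::nat) (\<Omega> :: real Matrix.vec set) (\<omega> :: real Matrix.vec measure) (F :: real Matrix.vec \<Rightarrow> real Matrix.vec)
      (E :: complex set \<Rightarrow> (real Matrix.vec \<Rightarrow> complex) \<Rightarrow> real Matrix.vec \<Rightarrow> complex)
      (N::nat) (M::nat) (\<psi> :: nat \<Rightarrow> real Matrix.vec \<Rightarrow> complex)
      (x :: nat \<Rightarrow> real Matrix.vec) (y :: nat \<Rightarrow> real Matrix.vec) (w :: nat \<Rightarrow> real)
      (G :: complex mat) (A :: complex mat) (K :: complex mat) (V :: complex mat)
      (lam :: nat \<Rightarrow> complex).
    measure_preserving_system d \<Omega> \<omega> F \<longrightarrow>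
    koopman_spectral_measure \<omega> F E \<longrightarrow>
    (\<forall>j<N. \<psi> j \<in> L2_carrier \<omega>) \<longrightarrow>
    (\<forall>m<M. x m \<in> \<Omega> \<and> y m = F (x m) \<and> 0 \<le> w m) \<longrightarrow>
    G = gram_mat M N \<psi> x w \<longrightarrow> A = cross_mat M N \<psi> x y w \<longrightarrow>
    invertible_mat G \<longrightarrow>
    mpEDMD N G A K V lam \<longrightarrow>
    (\<forall>(L::nat) g c.
      2 \<le> L \<longrightarrow> g \<in> L2_carrier \<omega> \<longrightarrow> L2_norm \<omega> g = 1 \<longrightarrow>
      c \<in> carrier_vec N \<longrightarrow> (G *\<^sub>v c) \<bullet>c c = 1 \<longrightarrow>
      W1 (scalar_spectral_measure (L2_inner \<omega>) E g) (mpEDMD_measure N G V lam c)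
        \<le> ereal (C * (ln (real L) / real L +
            (\<Sum>l=1..L. cmod (L2_inner \<omega> ((koopman F ^^ l) g) g
                              - ((G * K ^\<^sub>m l) *\<^sub>v c) \<bullet>c c) / real l))))"
\<comment> \<open>The constant is the 2 pi from the two approximation errors times the 2 of
  \<open>inverse_Suc_le_ln_div\<close>; the moment sum itself comes with pi only.\<close>
proof (intro exI[of _ "4 * pi"] conjI allI impI)
  show "4 * pi > 0" by simp
next
  fix d :: nat and \<Omega> \<omega> F E and N M :: nat and \<psi> x y w G A K V lam and L :: nat and g c
  assume sys: "measure_preserving_system d \<Omega> \<omega> F" and E: "koopman_spectral_measure \<omega> F E"
    and G: "G = gram_mat M N \<psi> x w" and mp: "mpEDMD N G A K V lam"
    and L: "2 \<le> L" and g: "g \<in> L2_carrier \<omega>" "L2_norm \<omega> g = 1"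
    and c: "c \<in> carrier_vec N" "(G *\<^sub>v c) \<bullet>c c = 1"
  let ?\<mu> = "scalar_spectral_measure (L2_inner \<omega>) E g" and ?\<nu> = "mpEDMD_measure N G V lam c"
  define S where "S = (\<Sum>l=1..L. cmod (L2_inner \<omega> ((koopman F ^^ l) g) g - ((G * K ^\<^sub>m l) *\<^sub>v c) \<bullet>c c) / real l)"
  have Gc: "G \<in> carrier_mat N N" by (auto simp: G gram_mat_def dict_mat_def)
  have S: "S \<ge> 0" by (simp add: S_def sum_nonneg)
  have "W1 ?\<mu> ?\<nu> \<le> ereal (2 * pi / real (Suc L) + pi * S)"
    unfolding S_def koopman_spectral_measure_prob_moments(2)[OF sys E g, symmetric]
      mpEDMD_measure_moment[OF mp c(1), symmetric]
    by (rule W1_moment_bound)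
      (use L koopman_spectral_measure_prob_moments(1)[OF sys E g] prob_space_mpEDMD_measure[OF mp Gc c] in auto)
  also have "2 * pi / real (Suc L) + pi * S \<le> 4 * pi * (ln (real L) / real L + S)"
  proof -
    have "2 * pi / real (Suc L) = 2 * pi * (1 / real (Suc L))" by simp
    also have "\<dots> \<le> 2 * pi * (2 * (ln (real L) / real L))"
      by (intro mult_left_mono inverse_Suc_le_ln_div L) auto
    finally have "2 * pi / real (Suc L) \<le> 4 * pi * (ln (real L) / real L)" by simp
    moreover have "pi * S \<le> 4 * pi * S" using S by (intro mult_right_mono) auto
    ultimately show ?thesis by (simp only: distrib_left)
  qed
  finally show "W1 ?\<mu> ?\<nu> \<le> ereal (4 * pi * (ln (real L) / real L +
      (\<Sum>l=1..L. cmod (L2_inner \<omega> ((koopman F ^^ l) g) g - ((G * K ^\<^sub>m l) *\<^sub>v c) \<bullet>c c) / real l)))"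
    by (simp add: S_def)
qed

end
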